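(* Let $n\ge 1$ and $N=\{1,\dots,n\}$. The set $[\mathsf{R}^n,\mathsf{R}]$ of homotopy classes of continuous maps $\mathsf{R}^n\to\mathsf{R}$ is in bijection with the set of antichains of $\mathcal{P}(N)\setminus\{\emptyset\}$.
   Context: $\mathsf{R}$ denotes Alexandroff's closed long ray: the set $\omega_1\times[0,1[$ with the lexicographic order and the order topology; $\mathsf{R}^n$ has the product topology. Homotopy means free homotopy. $\mathcal{P}(N)$ is the power set of $N$, ordered by inclusion. An antichain in a partially ordered set is a set of pairwise incomparable elements; the empty antichain is included. *)

theory Defs
  imports "HOL-Analysis.Analysis" "HOL-Library.Countable_Set_Type"
begin

unbundle cardinal_syntax

section \<open>The first uncountable ordinal\<close>

text \<open>
  As an initial ordinal, \<open>\<omega>\<^sub>1\<close> is the well-order \<open>cardSuc natLeq\<close>; only its order type matters.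
  The lemmas \<open>uncountable_omega1\<close> and \<open>countable_lessThan_omega1\<close> below characterize that type:
  an uncountable well-order all of whose proper initial segments are countable.
\<close>

lemma Card_order_omega1: "Card_order (cardSuc natLeq)"
  by (simp add: cardSuc_Card_order natLeq_Card_order)

lemma Well_order_omega1: "Well_order (cardSuc natLeq)"
  using Card_order_omega1 card_order_on_well_order_on by blast

lemma infinite_Field_omega1: "infinite (Field (cardSuc natLeq))"
  unfolding cardSuc_finite[OF natLeq_Card_order] Field_natLeq by simp

typedef omega1 = "Field (cardSuc natLeq)"
  using infinite_imp_nonempty[OF infinite_Field_omega1] by blast

instantiation omega1 :: wellorder
begin

definition less_eq_omega1 :: "omega1 \<Rightarrow> omega1 \<Rightarrow> bool"
  where "a \<le> b \<longleftrightarrow> (Rep_omega1 a, Rep_omega1 b) \<in> cardSuc natLeq"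

definition less_omega1 :: "omega1 \<Rightarrow> omega1 \<Rightarrow> bool"
  where "a < b \<longleftrightarrow> a \<le> b \<and> \<not> b \<le> (a::omega1)"

instance
proof -
  interpret W: wo_rel "cardSuc natLeq"
    using Well_order_omega1 by (simp add: wo_rel_def)
  have refl: "a \<le> a" for a :: omega1
    using W.REFL Rep_omega1[of a] by (auto simp: less_eq_omega1_def refl_on_def)
  have antisym: "a = b" if "a \<le> b" "b \<le> a" for a b :: omega1
    using antisymD[OF W.ANTISYM, of "Rep_omega1 a" "Rep_omega1 b"] that
    by (simp add: less_eq_omega1_def Rep_omega1_inject)
  have trans: "a \<le> c" if "a \<le> b" "b \<le> c" for a b c :: omega1
    using that transD[OF W.TRANS] by (simp add: less_eq_omega1_def)
  have total: "a \<le> b \<or> b \<le> a" for a b :: omega1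
    using W.TOTALS Rep_omega1[of a] Rep_omega1[of b] unfolding less_eq_omega1_def by blast
  have wf_less: "wf {(a, b :: omega1). a < b}"
  proof (rule wf_subset)
    show "wf (inv_image (cardSuc natLeq - Id) Rep_omega1)"
      using W.WF by (rule wf_inv_image)
    show "{(a, b :: omega1). a < b} \<subseteq> inv_image (cardSuc natLeq - Id) Rep_omega1"
      by (auto simp: less_omega1_def less_eq_omega1_def inv_image_def)
  qed
  have wf: "P a" if "\<And>x. (\<And>y. y < x \<Longrightarrow> P y) \<Longrightarrow> P x" for P and a :: omega1
  proof (induction a rule: wf_induct_rule[OF wf_less])
    case (1 x)
    then show ?case by (simp add: that)
  qed
  show "OFCLASS(omega1, wellorder_class)"
  proof
    fix a b c :: omega1
    show "a < b \<longleftrightarrow> a \<le> b \<and> \<not> b \<le> a"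
      by (rule less_omega1_def)
    show "a \<le> a" by (rule refl)
    show "a \<le> c" if "a \<le> b" "b \<le> c" using that by (rule trans)
    show "a = b" if "a \<le> b" "b \<le> a" using that by (rule antisym)
    show "a \<le> b \<or> b \<le> a" by (rule total)
    show "P a" if "\<And>x. (\<And>y. y < x \<Longrightarrow> P y) \<Longrightarrow> P x" for P
      using that by (rule wf)
  qed
qed

end

lemma uncountable_omega1: "uncountable (UNIV :: omega1 set)"
proof
  assume "countable (UNIV :: omega1 set)"
  then have "countable (range Rep_omega1)" by simp
  then have "countable (Field (cardSuc natLeq))"
    using type_definition.Rep_range[OF type_definition_omega1] by simp
  then have "|Field (cardSuc natLeq)| \<le>o natLeq"
    by (simp add: countable_card_le_natLeq)
  moreover have "(card_of (Field (cardSuc natLeq)), cardSuc natLeq) \<in> ordIso"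
    using Card_order_omega1 card_of_Field_ordIso by blast
  ultimately have "cardSuc natLeq \<le>o natLeq"
    using ordIso_ordLeq_trans ordIso_symmetric by blast
  then show False
    using cardSuc_greater[OF natLeq_Card_order] not_ordLess_ordLeq by blast
qed

lemma countable_lessThan_omega1: "countable {..< a :: omega1}"
proof -
  have "|underS (cardSuc natLeq) (Rep_omega1 a)| <o cardSuc natLeq"
    using card_of_underS[OF Card_order_omega1 Rep_omega1[of a]] .
  then have "|underS (cardSuc natLeq) (Rep_omega1 a)| \<le>o natLeq"
    using cardSuc_ordLeq_ordLess[OF natLeq_Card_order card_of_Card_order] by blast
  then have "countable (underS (cardSuc natLeq) (Rep_omega1 a))"
    by (simp add: countable_card_le_natLeq)
  moreover have "Rep_omega1 ` {..<a} \<subseteq> underS (cardSuc natLeq) (Rep_omega1 a)"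
    by (auto simp: underS_def less_omega1_def less_eq_omega1_def)
  ultimately have "countable (Rep_omega1 ` {..<a})"
    using countable_subset by blast
  then show ?thesis
    by (rule countable_image_inj_on) (simp add: inj_on_def Rep_omega1_inject)
qed

unbundle no cardinal_syntax

section \<open>The closed long ray\<close>

typedef long_ray = "(UNIV :: omega1 set) \<times> {0..<1::real}"
  by (rule exI[of _ "(undefined, 0)"]) simp

instantiation long_ray :: linorder
begin

definition less_eq_long_ray :: "long_ray \<Rightarrow> long_ray \<Rightarrow> bool"
  where "x \<le> y \<longleftrightarrow>
    fst (Rep_long_ray x) < fst (Rep_long_ray y) \<or>
    fst (Rep_long_ray x) = fst (Rep_long_ray y) \<and> snd (Rep_long_ray x) \<le> snd (Rep_long_ray y)"

definition less_long_ray :: "long_ray \<Rightarrow> long_ray \<Rightarrow> bool"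
  where "x < y \<longleftrightarrow> x \<le> y \<and> \<not> y \<le> (x::long_ray)"

instance
proof
  fix x y :: long_ray
  assume "x \<le> y" "y \<le> x"
  then have "Rep_long_ray x = Rep_long_ray y"
    by (auto simp: less_eq_long_ray_def prod_eq_iff)
  then show "x = y"
    by (simp add: Rep_long_ray_inject)
qed (auto simp: less_eq_long_ray_def less_long_ray_def)

end

instantiation long_ray :: linorder_topology
begin

definition open_long_ray :: "long_ray set \<Rightarrow> bool"
  where "open_long_ray =
    generate_topology (range (\<lambda>a. {..< a}) \<union> range (\<lambda>a. {a <..}))"

instance
  by intro_classes (simp add: open_long_ray_def)

end

definition long_ray_power :: "nat \<Rightarrow> (nat \<Rightarrow> long_ray) topology"
  where "long_ray_power n = product_topology (\<lambda>_. euclidean) {1..n}"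

section \<open>Free homotopy classes\<close>

text \<open>
  Continuous maps are represented by total functions. Two continuous maps that agree on
  \<open>topspace X\<close> are homotopic in the sense of \<^const>\<open>homotopic_with\<close>, so their values elsewhere
  do not affect the quotient.
\<close>

definition homotopy_classes :: "'a topology \<Rightarrow> 'b topology \<Rightarrow> ('a \<Rightarrow> 'b) set set"
  where "homotopy_classes X Y =
    {f. continuous_map X Y f} // {(f, g). homotopic_with (\<lambda>_. True) X Y f g}"

lemma equiv_homotopic:
  "equiv {f. continuous_map X Y f} {(f, g). homotopic_with (\<lambda>_. True) X Y f g}"
proof (rule equivI)
  show "{(f, g). homotopic_with (\<lambda>_. True) X Y f g} \<subseteq>
      {f. continuous_map X Y f} \<times> {f. continuous_map X Y f}"
    using homotopic_with_imp_continuous_maps by fastforce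
  show "refl_on {f. continuous_map X Y f} {(f, g). homotopic_with (\<lambda>_. True) X Y f g}"
    by (simp add: refl_on_def)
  show "sym {(f, g). homotopic_with (\<lambda>_. True) X Y f g}"
    by (simp add: sym_def homotopic_with_sym)
  show "trans {(f, g). homotopic_with (\<lambda>_. True) X Y f g}"
    unfolding trans_def by (blast intro: homotopic_with_trans)
qed

lemma homotopic_if_eq_on_topspace:
  assumes "continuous_map X Y f" "continuous_map X Y g" "\<And>x. x \<in> topspace X \<Longrightarrow> f x = g x"
  shows "homotopic_with (\<lambda>_. True) X Y f g"
  using assms by (intro homotopic_with_equal) auto

section \<open>Antichains for inclusion\<close>

definition antichains :: "'a set set \<Rightarrow> 'a set set set"
  where "antichains P = {A. A \<subseteq> P \<and> pairwise (\<lambda>S T. \<not> S \<subseteq> T \<and> \<not> T \<subseteq> S) A}"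

end

theory Submission
  imports Defs
begin

text \<open>
  A map \<open>g\<close> on the power \<open>R\<^sup>I\<close> is classified by its unbounded faces: the sets \<open>T\<close>
  such that \<open>g\<close> is unbounded on the ray \<open>c \<mapsto> (c\<close> on \<open>T\<close>, \<open>0\<close> elsewhere\<open>)\<close>.
  An unbounded continuous map of the long ray to itself fixes a closed unbounded set, so in a
  family of maps with connected separable parameter space either all members are bounded or all
  fix a common closed unbounded set. Applied to a homotopy this makes the set of unbounded faces
  an invariant; applied to the remaining coordinates, which range over a separable box, it makes
  that set upward closed and yields cofinally many levels \<open>c\<close> such that \<open>g x \<ge> c\<close> if
  \<open>{i. x i \<ge> c}\<close> is an unbounded face and \<open>g x \<le> c\<close> if \<open>{i. x i > c}\<close> is not.
  For the antichain \<open>A\<close> of minimal unbounded faces, no such level lies strictly between \<open>g x\<close>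
  and \<open>max\<^bsub>S \<in> A\<^esub> min\<^bsub>i \<in> S\<^esub> x i\<close>, so the two maps can be joined along paths
  inside the segments cut out by these levels.
\<close>

section \<open>The long ray as a linear continuum\<close>

text \<open>If \<open>B\<close> were cofinal, the countable initial segments up to its elements
  would cover \<open>omega1\<close>, making it a countable union of countable sets.\<close>

lemma countable_imp_bounded_omega1:
  fixes B :: "omega1 set"
  assumes "countable B"
  shows "\<exists>\<beta>. \<forall>b\<in>B. b < \<beta>"
proof (rule ccontr)
  assume "\<nexists>\<beta>. \<forall>b\<in>B. b < \<beta>"
  then have "\<exists>b\<in>B. \<beta> \<le> b" for \<beta>
    by (meson not_less)
  then have "UNIV \<subseteq> (\<Union>b\<in>B. insert b {..<b})"
    by (force simp: le_less)
  moreover have "countable (\<Union>b\<in>B. insert b {..<b})"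
    using assms countable_lessThan_omega1 by blast
  ultimately show False
    using uncountable_omega1 countable_subset by blast
qed

section \<open>Coordinates and countable bounds on the ray\<close>

definition ray :: "omega1 \<Rightarrow> real \<Rightarrow> long_ray"
  where "ray \<alpha> r = Abs_long_ray (\<alpha>, r)"

lemma Rep_ray [simp]: "0 \<le> r \<Longrightarrow> r < 1 \<Longrightarrow> Rep_long_ray (ray \<alpha> r) = (\<alpha>, r)"
  by (simp add: ray_def Abs_long_ray_inverse)

lemma ray_cases:
  obtains \<alpha> r where "x = ray \<alpha> r" "0 \<le> r" "r < 1"
proof -
  obtain \<alpha> r where *: "Rep_long_ray x = (\<alpha>, r)" by fastforce
  with Rep_long_ray[of x] have "0 \<le> r" "r < 1" by auto
  moreover have "x = ray \<alpha> r"
    unfolding ray_def *[symmetric] by (rule Rep_long_ray_inverse[symmetric])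
  ultimately show thesis using that by blast
qed

lemma ray_le_iff:
  assumes "0 \<le> r" "r < 1" "0 \<le> s" "s < 1"
  shows "ray \<alpha> r \<le> ray \<beta> s \<longleftrightarrow> \<alpha> < \<beta> \<or> \<alpha> = \<beta> \<and> r \<le> s"
  using assms by (simp add: less_eq_long_ray_def)

lemma ray_less_iff:
  assumes "0 \<le> r" "r < 1" "0 \<le> s" "s < 1"
  shows "ray \<alpha> r < ray \<beta> s \<longleftrightarrow> \<alpha> < \<beta> \<or> \<alpha> = \<beta> \<and> r < s"
  using assms by (auto simp: less_long_ray_def ray_le_iff)

text \<open>Uncountable cofinality passes from \<open>omega1\<close> to the ray through first
  coordinates. It makes every sequence bounded and drives the closing-off arguments.\<close>

lemma countable_imp_strictly_bounded:
  fixes A :: "long_ray set"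
  assumes "countable A"
  shows "\<exists>b. \<forall>a\<in>A. a < b"
proof -
  have "countable ((\<lambda>x. fst (Rep_long_ray x)) ` A)"
    using assms by simp
  from countable_imp_bounded_omega1[OF this]
  obtain \<beta> where "\<forall>x\<in>A. fst (Rep_long_ray x) < \<beta>"
    by auto
  then have "\<forall>a\<in>A. a < ray \<beta> 0"
    by (auto simp: less_long_ray_def less_eq_long_ray_def)
  then show ?thesis by blast
qed

instantiation long_ray :: order_bot
begin

definition bot_long_ray :: long_ray
  where "bot = ray (LEAST \<alpha>. True) 0"

instance
proof
  fix a :: long_ray
  obtain \<alpha> r where a: "a = ray \<alpha> r" "0 \<le> r" "r < 1" by (rule ray_cases)
  have "(LEAST \<alpha>. True) \<le> \<alpha>"
    by (rule Least_le) simp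
  with a show "bot \<le> a"
    by (auto simp: bot_long_ray_def ray_le_iff)
qed

end

text \<open>The least first coordinate \<open>\<alpha>\<close> of an upper bound is chosen first,
  then the infimum of the second coordinates that give upper bounds over \<open>\<alpha>\<close>. It
  stays below 1 because some such coordinate does.\<close>

lemma long_ray_lub_exists:
  fixes A :: "long_ray set"
  assumes "bdd_above A"
  shows "\<exists>s. (\<forall>x\<in>A. x \<le> s) \<and> (\<forall>z. (\<forall>x\<in>A. x \<le> z) \<longrightarrow> s \<le> z)"
proof -
  let ?ub = "\<lambda>z. \<forall>x\<in>A. x \<le> z"
  let ?P = "\<lambda>\<alpha>. \<exists>r. 0 \<le> r \<and> r < 1 \<and> ?ub (ray \<alpha> r)"
  define \<alpha> where "\<alpha> = Least ?P"
  have "\<exists>z. ?ub z"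
    using assms by (auto simp: bdd_above_def)
  then have "\<exists>\<alpha>. ?P \<alpha>"
    by (metis ray_cases)
  then have P: "?P \<alpha>"
    unfolding \<alpha>_def by (rule LeastI_ex)
  define R where "R = {r. 0 \<le> r \<and> r < 1 \<and> ?ub (ray \<alpha> r)}"
  have R: "R \<noteq> {}" "bdd_below R"
    using P by (auto simp: R_def bdd_below_def)
  have "Inf R \<ge> 0"
    using R(1) by (intro cInf_greatest) (auto simp: R_def)
  obtain r0 where "r0 \<in> R" using R by blast
  then have "Inf R \<le> r0" using R(2) by (rule cInf_lower)
  then have lt1: "Inf R < 1" using \<open>r0 \<in> R\<close> by (simp add: R_def)
  have "x \<le> ray \<alpha> (Inf R)" if "x \<in> A" for x
  proof (cases x rule: ray_cases)
    case (1 \<beta> s)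
    have *: "\<beta> < \<alpha> \<or> \<beta> = \<alpha> \<and> s \<le> r" if "r \<in> R" for r
      using that \<open>x \<in> A\<close> 1 by (auto simp: R_def ray_le_iff)
    show ?thesis
    proof (cases "\<beta> < \<alpha>")
      case False
      then have "\<beta> = \<alpha>" "s \<le> Inf R"
        using * \<open>r0 \<in> R\<close> by (auto intro!: cInf_greatest R)
      then show ?thesis using 1 \<open>Inf R \<ge> 0\<close> lt1 by (simp add: ray_le_iff)
    qed (use 1 \<open>Inf R \<ge> 0\<close> lt1 in \<open>simp add: ray_le_iff\<close>)
  qed
  moreover have "ray \<alpha> (Inf R) \<le> z" if "?ub z" for z
  proof (cases z rule: ray_cases)
    case (1 \<beta> s)
    then have "\<alpha> \<le> \<beta>"
      unfolding \<alpha>_def using that by (intro Least_le) auto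
    moreover have "Inf R \<le> s" if "\<alpha> = \<beta>"
      using 1 that \<open>?ub z\<close> R(2) by (intro cInf_lower) (auto simp: R_def)
    ultimately show ?thesis
      using 1 \<open>Inf R \<ge> 0\<close> lt1 by (auto simp: ray_le_iff)
  qed
  ultimately show ?thesis by blast
qed

text \<open>The class of linear continua rests on lattice operations, which a linear order forces to
  be \<open>min\<close> and \<open>max\<close>.\<close>

instantiation long_ray :: distrib_lattice
begin

definition inf_long_ray :: "long_ray \<Rightarrow> long_ray \<Rightarrow> long_ray"
  where "inf_long_ray = min"

definition sup_long_ray :: "long_ray \<Rightarrow> long_ray \<Rightarrow> long_ray"
  where "sup_long_ray = max"

instance
  by standard (auto simp: inf_long_ray_def sup_long_ray_def max_min_distrib2)

end

instantiation long_ray :: linear_continuum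
begin

definition Sup_long_ray :: "long_ray set \<Rightarrow> long_ray"
  where "Sup_long_ray A = (SOME s. (\<forall>x\<in>A. x \<le> s) \<and> (\<forall>z. (\<forall>x\<in>A. x \<le> z) \<longrightarrow> s \<le> z))"

definition Inf_long_ray :: "long_ray set \<Rightarrow> long_ray"
  where "Inf_long_ray A = Sup {z. \<forall>x\<in>A. z \<le> x}"

instance
proof
  have Sup: "(\<forall>x\<in>A. x \<le> Sup A) \<and> (\<forall>z. (\<forall>x\<in>A. x \<le> z) \<longrightarrow> Sup A \<le> z)"
    if "bdd_above A" for A :: "long_ray set"
    unfolding Sup_long_ray_def using long_ray_lub_exists[OF that] by (rule someI_ex)
  have bdd: "bdd_above {z. \<forall>x\<in>A. z \<le> x}" if "A \<noteq> {}" for A :: "long_ray set"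
    using that by (auto simp: bdd_above_def)
  fix x z :: long_ray and A :: "long_ray set"
  show "x \<le> Sup A" if "x \<in> A" "bdd_above A"
    using Sup that by blast
  show "Sup A \<le> z" if "A \<noteq> {}" "\<And>x. x \<in> A \<Longrightarrow> x \<le> z"
    using Sup[of A] that by (auto simp: bdd_above_def)
  show "Inf A \<le> x" if "x \<in> A" "bdd_below A"
    unfolding Inf_long_ray_def using Sup[OF bdd, of A] that by blast
  show "z \<le> Inf A" if "A \<noteq> {}" "\<And>x. x \<in> A \<Longrightarrow> z \<le> x"
    unfolding Inf_long_ray_def using Sup[OF bdd, of A] that by blast
next
  fix x y :: long_ray
  assume "x < y"
  obtain \<alpha> r where x: "x = ray \<alpha> r" "0 \<le> r" "r < 1" by (rule ray_cases)
  obtain \<beta> s where y: "y = ray \<beta> s" "0 \<le> s" "s < 1" by (rule ray_cases)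
  show "\<exists>z>x. z < y"
  proof (cases "\<alpha> < \<beta>")
    case True
    then show ?thesis
      using x y by (intro exI[of _ "ray \<alpha> ((r + 1) / 2)"]) (simp add: ray_less_iff)
  next
    case False
    then have "\<alpha> = \<beta>" "r < s" using x y \<open>x < y\<close> by (auto simp: ray_less_iff)
    then show ?thesis
      using x y by (intro exI[of _ "ray \<alpha> ((r + s) / 2)"]) (simp add: ray_less_iff)
  qed
next
  show "\<exists>a b :: long_ray. a \<noteq> b"
    using countable_imp_strictly_bounded[of "{bot}"] by (metis countable_empty countable_insert insertI1 less_irrefl)
qed

end

instance long_ray :: linear_continuum_topology ..

instance long_ray :: no_top
proof
  fix x :: long_ray
  show "\<exists>y. x < y"
    using countable_imp_strictly_bounded[of "{x}"] by auto
qed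

section \<open>Sequences in the long ray\<close>

lemma countable_imp_upper_bound:
  fixes f :: "'a \<Rightarrow> long_ray"
  assumes "countable A"
  obtains b where "\<And>x. x \<in> A \<Longrightarrow> f x \<le> b"
proof -
  from countable_imp_strictly_bounded[OF countable_image[OF assms, of f]]
  obtain b where "\<forall>a\<in>f ` A. a < b" ..
  then show thesis by (intro that[of b]) (simp add: less_imp_le)
qed

text \<open>The range of a sequence is countable, hence bounded, so an increasing sequence always
  converges to its supremum.\<close>

lemma incseq_long_ray_converges:
  fixes X :: "nat \<Rightarrow> long_ray"
  assumes "incseq X"
  shows "X \<longlonglongrightarrow> (SUP m. X m)" "X m \<le> (SUP m. X m)"
proof -
  have bdd: "bdd_above (range X)"
    using countable_imp_strictly_bounded[of "range X"] by (auto simp: bdd_above_def intro: less_imp_le)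
  show le: "X m \<le> (SUP m. X m)" for m
    using bdd by (intro cSUP_upper) auto
  show "X \<longlonglongrightarrow> (SUP m. X m)"
  proof (rule order_tendstoI)
    fix a assume "a < (SUP m. X m)"
    then obtain k where "a < X k"
      using less_cSUP_iff[OF _ bdd] by auto
    then show "\<forall>\<^sub>F m in sequentially. a < X m"
      using assms by (auto simp: eventually_sequentially incseq_def intro: less_le_trans)
  next
    fix a assume "(SUP m. X m) < a"
    then show "\<forall>\<^sub>F m in sequentially. X m < a"
      by (intro always_eventually allI le_less_trans[OF le])
  qed
qed

text \<open>Some subsequence is monotone. If increasing, it is bounded by countability; if
  decreasing, \<open>bot\<close> bounds it below.\<close>

lemma long_ray_sequence_has_limit_point:
  fixes X :: "nat \<Rightarrow> long_ray"
  shows "\<exists>r l. strict_mono r \<and> (X \<circ> r) \<longlonglongrightarrow> l"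
proof -
  obtain r where r: "strict_mono r" "monoseq (\<lambda>k. X (r k))"
    using seq_monosub by blast
  then consider "incseq (X \<circ> r)" | "decseq (X \<circ> r)"
    by (auto simp: monoseq_iff o_def)
  then have "\<exists>l. (X \<circ> r) \<longlonglongrightarrow> l"
  proof cases
    case 1
    then show ?thesis using incseq_long_ray_converges by blast
  next
    case 2
    have bdd: "bdd_below (range (X \<circ> r))" by (meson bdd_below.I bot_least)
    have "(X \<circ> r) \<longlonglongrightarrow> (INF m. (X \<circ> r) m)"
    proof (rule order_tendstoI)
      fix a assume "(INF m. (X \<circ> r) m) < a"
      then obtain k where "(X \<circ> r) k < a"
        using cINF_less_iff[OF _ bdd] by auto
      then show "\<forall>\<^sub>F m in sequentially. (X \<circ> r) m < a"
        using 2 unfolding eventually_sequentially decseq_def by (meson le_less_trans)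
    next
      fix a assume "a < (INF m. (X \<circ> r) m)"
      moreover have "(INF m. (X \<circ> r) m) \<le> (X \<circ> r) m" for m
        using bdd by (intro cINF_lower) auto
      ultimately show "\<forall>\<^sub>F m in sequentially. a < (X \<circ> r) m"
        by (intro always_eventually allI) (rule less_le_trans)
    qed
    then show ?thesis by blast
  qed
  with r show ?thesis by blast
qed

text \<open>Subsequences are refined one coordinate at a time.\<close>

lemma finite_coordinates_converging_subsequence:
  fixes X :: "nat \<Rightarrow> 'i \<Rightarrow> long_ray"
  assumes "finite I"
  shows "\<exists>r y. strict_mono r \<and> (\<forall>i\<in>I. (\<lambda>k. X (r k) i) \<longlonglongrightarrow> y i)"
  using assms
proof induction
  case empty
  show ?case using strict_mono_id by auto
next
  case (insert j I)
  then obtain r y where r: "strict_mono r" "\<And>i. i \<in> I \<Longrightarrow> (\<lambda>k. X (r k) i) \<longlonglongrightarrow> y i"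
    by blast
  obtain s l where s: "strict_mono s" "((\<lambda>k. X (r k) j) \<circ> s) \<longlonglongrightarrow> l"
    using long_ray_sequence_has_limit_point by blast
  have "(\<lambda>k. X ((r \<circ> s) k) i) \<longlonglongrightarrow> (y(j := l)) i" if "i \<in> insert j I" for i
    using s(2) LIMSEQ_subseq_LIMSEQ[OF r(2) s(1), of i] that by (auto simp: o_def)
  then show ?case
    using strict_mono_o[OF r(1) s(1)] by blast
qed

text \<open>The closing-off argument: \<open>R u v\<close> says that \<open>v\<close> is large
  enough for what \<open>u\<close> demands. Iterating along the natural numbers leads to a limit
  \<open>c\<close> at which demands and answers meet.\<close>

lemma closing_off_chain:
  fixes a :: long_ray
  assumes "\<And>u. \<exists>v>u. R u v"
  obtains X c where "X 0 = a" "\<And>m. R (X m) (X (Suc m))"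
    "X \<longlonglongrightarrow> c" "\<And>m. X m < c" "incseq X"
proof -
  obtain s where s: "u < s u" "R u (s u)" for u
    using assms by metis
  define X where "X m = (s ^^ m) a" for m
  have X: "X 0 = a" "X m < X (Suc m)" "R (X m) (X (Suc m))" for m
    using s by (simp_all add: X_def)
  then have "incseq X"
    by (auto intro!: incseq_SucI less_imp_le)
  note lim = incseq_long_ray_converges[OF this]
  show thesis
    using X(1,3) lim(1) less_le_trans[OF X(2) lim(2)] \<open>incseq X\<close> by (rule that)
qed

section \<open>Separability of initial segments\<close>

definition grid :: "long_ray set"
  where "grid = (\<lambda>(\<alpha>, q). ray \<alpha> q) ` (UNIV \<times> (\<rat> \<inter> {0..<1}))"

lemma ray_in_grid: "q \<in> \<rat> \<Longrightarrow> 0 \<le> q \<Longrightarrow> q < 1 \<Longrightarrow> ray \<alpha> q \<in> grid"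
  by (force simp: grid_def)

text \<open>Only countably many first coordinates occur below a fixed point. So initial segments are
  separable, although countable sets are never dense in the whole ray.\<close>

lemma countable_grid: "countable (grid \<inter> {..a})"
proof (cases a rule: ray_cases)
  case (1 \<alpha> r)
  have "grid \<inter> {..a} \<subseteq> (\<lambda>(\<alpha>, q). ray \<alpha> q) ` (insert \<alpha> {..<\<alpha>} \<times> \<rat>)"
    using 1 by (auto simp: grid_def ray_le_iff)
  moreover have "countable ((\<lambda>(\<alpha>, q). ray \<alpha> q) ` (insert \<alpha> {..<\<alpha>} \<times> \<rat>))"
    by (intro countable_image countable_SIGMA) (simp_all add: countable_lessThan_omega1 countable_rat)
  ultimately show ?thesis by (rule countable_subset)
qed

lemma grid_dense:
  assumes "x < y"
  shows "\<exists>d\<in>grid. x \<le> d \<and> d < y"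
proof -
  obtain \<alpha> r where x: "x = ray \<alpha> r" "0 \<le> r" "r < 1" by (rule ray_cases)
  obtain \<beta> s where y: "y = ray \<beta> s" "0 \<le> s" "s < 1" by (rule ray_cases)
  \<comment> \<open>Points over \<open>\<alpha>\<close> and below \<open>y\<close> are those with
    second coordinate below \<open>t\<close>: the whole fibre if \<open>y\<close> lies over a later
    ordinal.\<close>
  define t where "t = (if \<alpha> < \<beta> then 1 else s)"
  have "r < t" using assms x y by (auto simp: t_def ray_less_iff)
  then obtain q where "q \<in> \<rat>" "r < q" "q < t" using Rats_dense_in_real by blast
  moreover have "t \<le> 1" using y by (simp add: t_def)
  ultimately have "ray \<alpha> q \<in> grid" "x \<le> ray \<alpha> q" "ray \<alpha> q < y"
    using x y assms
    by (auto simp: ray_le_iff ray_less_iff t_def intro!: ray_in_grid split: if_splits)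
  then show ?thesis by blast
qed

lemma bot_in_grid: "bot \<in> grid"
  by (simp add: bot_long_ray_def ray_in_grid)

text \<open>Approximating from below keeps the approximants in every initial segment, and later in
  every box, that contains the limit.\<close>

lemma grid_approximation:
  "\<exists>d. (\<forall>k::nat. d k \<in> grid \<and> d k \<le> x) \<and> d \<longlonglongrightarrow> x"
proof (cases "x = bot")
  case True
  then show ?thesis using bot_in_grid by (intro exI[of _ "\<lambda>_. bot"]) auto
next
  case False
  obtain \<alpha> r where x: "x = ray \<alpha> r" "0 \<le> r" "r < 1" by (rule ray_cases)
  show ?thesis
  proof (cases "r = 0")
    case True
    then have "x \<in> grid" using x by (simp add: ray_in_grid)
    then show ?thesis by (intro exI[of _ "\<lambda>_. x"]) auto
  next
    case False
    have "\<exists>q\<in>\<rat>. max 0 (r - 1 / Suc k) < q \<and> q < r" for k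
      using x False by (intro Rats_dense_in_real) auto
    then obtain q where q: "\<And>k. q k \<in> \<rat>" "\<And>k. max 0 (r - 1 / Suc k) < q k" "\<And>k. q k < r"
      by metis
    have qr: "q \<longlonglongrightarrow> r"
    proof (rule real_tendsto_sandwich)
      show "\<forall>\<^sub>F k in sequentially. r - 1 / Suc k \<le> q k" "\<forall>\<^sub>F k in sequentially. q k \<le> r"
        using q by (auto intro!: always_eventually less_imp_le simp: less_le_trans)
      show "(\<lambda>k. r - 1 / Suc k) \<longlonglongrightarrow> r"
        using tendsto_diff[OF tendsto_const LIMSEQ_inverse_real_of_nat, of r]
        by (simp add: inverse_eq_divide)
    qed simp
    have bnd: "0 \<le> q k" "q k < 1" for k
      using q(2)[of k] q(3)[of k] x by auto
    have "(\<lambda>k. ray \<alpha> (q k)) \<longlonglongrightarrow> x"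
    proof (rule order_tendstoI)
      fix a assume "x < a"
      moreover have "ray \<alpha> (q k) \<le> x" for k
        using x q(3)[of k] bnd[of k] by (simp add: ray_le_iff)
      ultimately show "\<forall>\<^sub>F k in sequentially. ray \<alpha> (q k) < a"
        by (blast intro: always_eventually le_less_trans)
    next
      fix a assume "a < x"
      obtain \<beta> s where a: "a = ray \<beta> s" "0 \<le> s" "s < 1" by (rule ray_cases)
      show "\<forall>\<^sub>F k in sequentially. a < ray \<alpha> (q k)"
      proof (cases "\<beta> < \<alpha>")
        case True
        then show ?thesis using a bnd by (simp add: ray_less_iff)
      next
        case False
        then have "\<beta> = \<alpha>" "s < r" using a x \<open>a < x\<close> by (auto simp: ray_less_iff)
        then show ?thesis
          using order_tendstoD(1)[OF qr \<open>s < r\<close>] a bnd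
          by (auto simp: ray_less_iff elim!: eventually_mono)
      qed
    qed
    moreover have "ray \<alpha> (q k) \<in> grid \<and> ray \<alpha> (q k) \<le> x" for k
      using bnd[of k] q(1)[of k] q(3)[of k] x by (simp add: ray_in_grid ray_le_iff)
    ultimately show ?thesis by (intro exI[of _ "\<lambda>k. ray \<alpha> (q k)"]) auto
  qed
qed

section \<open>Closed unbounded sets and separable families of maps\<close>

lemma tendsto_coordinatewiseI:
  fixes F :: "nat \<Rightarrow> 'i \<Rightarrow> 'a :: topological_space"
  assumes "\<And>i. (\<lambda>k. F k i) \<longlonglongrightarrow> l i"
  shows "F \<longlonglongrightarrow> l"
proof -
  have "limitin (product_topology (\<lambda>_. euclidean) UNIV) F l sequentially"
    using assms by (simp add: limitin_componentwise)
  then show ?thesis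
    by (simp add: euclidean_product_topology)
qed

lemma grid_closure: "closure (grid \<inter> {..a}) = {..a}"
proof
  show "closure (grid \<inter> {..a}) \<subseteq> {..a}"
    by (rule closure_minimal) auto
  show "{..a} \<subseteq> closure (grid \<inter> {..a})"
  proof
    fix x assume "x \<in> {..a}"
    obtain d where d: "\<And>k::nat. d k \<in> grid \<and> d k \<le> x" "d \<longlonglongrightarrow> x"
      using grid_approximation by blast
    have "d k \<in> closure (grid \<inter> {..a})" for k
      using d(1)[of k] \<open>x \<in> {..a}\<close> closure_subset by fastforce
    then show "x \<in> closure (grid \<inter> {..a})"
      using d(2) by (intro Lim_in_closed_set[of _ d sequentially]) auto
  qed
qed

text \<open>Countably many values have an upper bound \<open>b\<close>, and the bound passes to the
  closure because \<open>{..b}\<close> is closed.\<close>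

lemma continuous_bounded_on_separable:
  fixes f :: "'a :: topological_space \<Rightarrow> long_ray"
  assumes "countable Q" "continuous_on (closure Q) f"
  shows "\<exists>b. \<forall>x\<in>closure Q. f x \<le> b"
proof -
  obtain b where "\<And>x. x \<in> Q \<Longrightarrow> f x \<le> b"
    using countable_imp_upper_bound[where f = f, OF assms(1)] by blast
  then have "f ` closure Q \<subseteq> {..b}"
    using assms(2) by (intro image_closure_subset) auto
  then show ?thesis by blast
qed

section \<open>Closed unbounded sets\<close>

definition club :: "long_ray set \<Rightarrow> bool"
  where "club C \<longleftrightarrow> closed C \<and> (\<forall>a. \<exists>c\<in>C. a < c)"

text \<open>A chain is built with a point of every \<open>C k\<close> between consecutive terms. For
  each \<open>k\<close> these points converge to the limit of the chain, which therefore lies in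
  every closed set \<open>C k\<close>.\<close>

lemma club_countable_Inter:
  assumes "countable A" "\<And>k. k \<in> A \<Longrightarrow> club (C k)"
  shows "club (\<Inter>k\<in>A. C k)"
  unfolding club_def
proof (intro conjI allI)
  show "closed (\<Inter>k\<in>A. C k)"
    using assms(2) by (intro closed_INT) (auto simp: club_def)
  fix a
  let ?R = "\<lambda>u v. \<forall>k\<in>A. \<exists>z\<in>C k. u < z \<and> z \<le> v"
  have "\<exists>v>u. ?R u v" for u
  proof -
    have "\<forall>k\<in>A. \<exists>z\<in>C k. u < z"
      using assms(2) unfolding club_def by blast
    then obtain z where z: "\<And>k. k \<in> A \<Longrightarrow> z k \<in> C k \<and> u < z k"
      by metis
    obtain v where v: "\<And>x. x \<in> insert u (z ` A) \<Longrightarrow> x < v"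
      using countable_imp_strictly_bounded[of "insert u (z ` A)"] assms(1) by auto
    have "z k \<in> C k \<and> u < z k \<and> z k \<le> v" if "k \<in> A" for k
      using z[OF that] v[of "z k"] that by (auto intro: less_imp_le)
    with v[of u] show ?thesis by blast
  qed
  then obtain X c where X: "X 0 = a" "\<And>m. ?R (X m) (X (Suc m))" "X \<longlonglongrightarrow> c"
    "\<And>m. X m < c" "incseq X"
    by (rule closing_off_chain[of ?R a]) (rule that)
  have "c \<in> C k" if "k \<in> A" for k
  proof -
    have "\<forall>m. \<exists>z. z \<in> C k \<and> X m < z \<and> z \<le> X (Suc m)"
      using X(2) that by blast
    from choice[OF this]
    obtain z where z: "\<And>m. z m \<in> C k \<and> X m < z m \<and> z m \<le> X (Suc m)"
      by blast
    have "z \<longlonglongrightarrow> c"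
      by (rule tendsto_sandwich[OF _ _ X(3) LIMSEQ_Suc[OF X(3)]])
        (use z in \<open>auto intro: always_eventually less_imp_le\<close>)
    moreover have "closed (C k)"
      using assms(2)[OF that] by (simp add: club_def)
    ultimately show ?thesis
      using z by (intro Lim_in_closed_set[of _ z sequentially]) auto
  qed
  then show "\<exists>c\<in>\<Inter>k\<in>A. C k. a < c"
    using X(1) X(4)[of 0] by auto
qed

text \<open>Along the chain \<open>X m < f (X (Suc m)) \<le> X (Suc (Suc m))\<close>. The values of
  \<open>f\<close> are thus squeezed to the limit \<open>c\<close> of the arguments, and continuity
  gives a fixed point.\<close>

lemma club_fixed_points:
  fixes f :: "long_ray \<Rightarrow> long_ray"
  assumes "continuous_on UNIV f" "\<not> bdd_above (range f)"
  shows "club {c. f c = c}"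
  unfolding club_def
proof (intro conjI allI)
  show "closed {c. f c = c}"
    using assms(1) by (intro closed_Collect_eq) auto
  fix a
  let ?R = "\<lambda>u v. u < f v \<and> f u \<le> v"
  have "\<exists>v>u. ?R u v" for u
  proof -
    have "\<exists>b. \<forall>x\<in>{..max u (f u)}. f x \<le> b"
      using continuous_bounded_on_separable[OF countable_grid, of "max u (f u)" f] assms(1)
      by (simp add: grid_closure continuous_on_subset)
    then obtain b where b: "\<And>x. x \<le> max u (f u) \<Longrightarrow> f x \<le> b" by auto
    \<comment> \<open>Up to \<open>max u (f u)\<close> the values of \<open>f\<close> are at most
      \<open>b\<close>, so a point with a larger value lies beyond.\<close>
    obtain v where v: "max u b < f v"
      using assms(2) by (auto simp: bdd_above_def not_le simp del: max_less_iff_conj)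
    then have "max u (f u) < v"
      using b[of v] by (meson leD le_less_linear max.strict_boundedE)
    with v show ?thesis by auto
  qed
  then obtain X c where X: "X 0 = a" "\<And>m. ?R (X m) (X (Suc m))" "X \<longlonglongrightarrow> c"
    "\<And>m. X m < c" "incseq X"
    by (rule closing_off_chain[of ?R a]) (rule that)
  have "(\<lambda>m. f (X (Suc m))) \<longlonglongrightarrow> c"
    by (rule tendsto_sandwich[OF _ _ X(3) LIMSEQ_Suc[OF LIMSEQ_Suc[OF X(3)]]])
      (use X(2) in \<open>auto intro: always_eventually less_imp_le\<close>)
  moreover have "(\<lambda>m. f (X (Suc m))) \<longlonglongrightarrow> f c"
    using continuous_on_tendsto_compose[OF assms(1) LIMSEQ_Suc[OF X(3)]] by simp
  ultimately have "f c = c" by (metis LIMSEQ_unique)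
  then show "\<exists>c\<in>{c. f c = c}. a < c"
    using X(1) X(4)[of 0] by auto
qed

lemma continuous_image_connected_subset:
  fixes f :: "'p :: topological_space \<Rightarrow> long_ray"
  assumes "connected P" "continuous_on P f" "f ` P \<subseteq> insert c {..b}" "b < c"
  shows "f ` P \<subseteq> {..b} \<or> f ` P \<subseteq> {c}"
proof -
  have "connected (f ` P)"
    using assms(1,2) by (rule connected_continuous_image[rotated])
  then show ?thesis
    unfolding connected_closed
  proof (rule contrapos_np)
    assume "\<not> (f ` P \<subseteq> {..b} \<or> f ` P \<subseteq> {c})"
    then show "\<exists>A B. closed A \<and> closed B \<and> f ` P \<subseteq> A \<union> B \<and> A \<inter> B \<inter> f ` P = {} \<and>
        A \<inter> f ` P \<noteq> {} \<and> B \<inter> f ` P \<noteq> {}"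
      using assms(3,4) by (intro exI[of _ "{..b}"] exI[of _ "{c}"]) auto
  qed
qed

text \<open>Over a countable dense set of parameters, the bounded members share a bound
  \<open>b\<close> and the unbounded ones fix a common club \<open>C\<close>. For
  \<open>c \<in> C\<close> above \<open>b\<close>, the values at \<open>c\<close> stay in the closed
  set \<open>insert c {..b}\<close>, and connectedness of the parameter space admits only one of its
  two pieces.\<close>

lemma unbounded_in_separable_family:
  fixes h :: "'p :: topological_space \<Rightarrow> long_ray \<Rightarrow> long_ray"
  assumes "connected (closure Q)" "countable Q"
    and "\<And>p. p \<in> closure Q \<Longrightarrow> continuous_on UNIV (h p)"
    and "\<And>c. continuous_on (closure Q) (\<lambda>p. h p c)"
    and "p\<^sub>0 \<in> closure Q"
  shows "if bdd_above (range (h p\<^sub>0)) then \<exists>b. \<forall>p\<in>closure Q. \<forall>c. h p c \<le> b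
    else club {c. \<forall>p\<in>closure Q. h p c = c}"
proof -
  \<comment> \<open>Adding \<open>p\<^sub>0\<close> keeps the set countable and lets this parameter
    decide the alternative.\<close>
  define Q' where "Q' = insert p\<^sub>0 Q"
  have Q': "closure Q' = closure Q" "countable Q'" "Q' \<subseteq> closure Q"
    using assms(2,5) closure_subset[of Q] closure_mono[of Q Q'] closure_minimal[of Q' "closure Q"]
    by (auto simp: Q'_def)
  define U where "U = {p\<in>Q'. \<not> bdd_above (range (h p))}"
  have "\<forall>p\<in>Q' - U. \<exists>b. \<forall>c. h p c \<le> b"
    by (auto simp: U_def bdd_above_def)
  then obtain B where B: "\<And>p c. p \<in> Q' - U \<Longrightarrow> h p c \<le> B p"
    by metis
  obtain b where "\<And>p. p \<in> Q' - U \<Longrightarrow> B p \<le> b"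
    using countable_imp_upper_bound[where f = B, OF countable_Diff[OF Q'(2), of U]] by blast
  then have b: "h p c \<le> b" if "p \<in> Q' - U" for p c
    using that by (metis B order_trans)
  define C where "C = (\<Inter>p\<in>U. {c. h p c = c})"
  have "club C"
    unfolding C_def using Q' assms(3)
    by (intro club_countable_Inter club_fixed_points) (auto simp: U_def)
  have dichotomy: "(\<forall>p\<in>closure Q. h p c \<le> b) \<or> (\<forall>p\<in>closure Q. h p c = c)"
    if "c \<in> C" "b < c" for c
  proof -
    have "(\<lambda>p. h p c) ` Q' \<subseteq> insert c {..b}"
      using that b by (force simp: C_def)
    then have "(\<lambda>p. h p c) ` closure Q' \<subseteq> insert c {..b}"
      by (intro image_closure_subset) (auto simp: Q' assms(4))
    then show ?thesis
      using continuous_image_connected_subset[OF assms(1) assms(4) _ \<open>b < c\<close>] Q'(1) by auto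
  qed
  have ex: "\<exists>c\<in>C. max a b < c" for a
    using \<open>club C\<close> unfolding club_def by blast
  show ?thesis
  proof (cases "bdd_above (range (h p\<^sub>0))")
    case True
    obtain c where c: "c \<in> C" "b < c" using ex by auto
    have "p\<^sub>0 \<in> Q' - U" using True by (simp add: U_def Q'_def)
    from b[OF this, of c] have "h p\<^sub>0 c \<noteq> c" using c(2) by auto
    then have *: "\<forall>p\<in>closure Q. h p c \<le> b"
      using dichotomy[OF c] assms(5) by blast
    \<comment> \<open>An unbounded member would fix \<open>c\<close>, against the bound just found
      at that level. Hence \<open>b\<close> bounds every member from the dense set at all
      levels.\<close>
    have "U = {}"
    proof (rule ccontr)
      assume "U \<noteq> {}"
      then obtain p where "p \<in> U" by blast
      then have "h p c = c" "p \<in> closure Q"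
        using c Q'(3) by (auto simp: C_def U_def)
      then show False using * c by auto
    qed
    have "(\<lambda>p. h p c) ` closure Q' \<subseteq> {..b}" for c
      using b \<open>U = {}\<close> by (intro image_closure_subset) (auto simp: Q' assms(4))
    then show ?thesis using True Q'(1) by auto
  next
    case False
    then have "p\<^sub>0 \<in> U" by (simp add: U_def Q'_def)
    have "{c. \<forall>p\<in>closure Q. h p c = c} = (\<Inter>p\<in>closure Q. {c. h p c = c})" by auto
    also have "closed \<dots>"
      using assms(3) by (intro closed_INT ballI closed_Collect_eq) auto
    finally have "closed {c. \<forall>p\<in>closure Q. h p c = c}" .
    moreover have "\<exists>c\<in>{c. \<forall>p\<in>closure Q. h p c = c}. a < c" for a
    proof -
      obtain c where c: "c \<in> C" "a < c" "b < c" using ex[of a] by auto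
      then have "h p\<^sub>0 c = c" using \<open>p\<^sub>0 \<in> U\<close> by (auto simp: C_def)
      then have "\<not> h p\<^sub>0 c \<le> b" using c by simp
      then have "\<forall>p\<in>closure Q. h p c = c"
        using dichotomy[OF c(1,3)] assms(5) by blast
      with c show ?thesis by blast
    qed
    ultimately show ?thesis using False by (simp add: club_def)
  qed
qed

section \<open>Boxes as connected separable parameter spaces\<close>

text \<open>Coordinates off \<open>I\<close> are pinned to \<open>bot\<close>, since
  \<open>{..bot}\<close> is a single point. For finite \<open>I\<close> this keeps the box separable
  over an arbitrary index type.\<close>

definition long_box :: "'i set \<Rightarrow> long_ray \<Rightarrow> ('i \<Rightarrow> long_ray) set"
  where "long_box I a = {y. \<forall>i. y i \<le> (if i \<in> I then a else bot)}"

lemma closed_long_box: "closed (long_box I a)"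
proof -
  have "long_box I a = (\<Inter>i. {y. y i \<le> (if i \<in> I then a else bot)})"
    by (simp add: long_box_def set_eq_iff)
  also have "closed \<dots>"
    by (intro closed_INT ballI closed_Collect_le) auto
  finally show ?thesis .
qed

lemma connected_long_box: "connected (long_box I a)"
proof -
  have "long_box I a = PiE UNIV (\<lambda>i. {..if i \<in> I then a else bot})"
    by (auto simp: long_box_def PiE_def Pi_def)
  moreover have "connectedin (product_topology (\<lambda>_. euclidean) UNIV)
      (PiE UNIV (\<lambda>i. {..if i \<in> I then a else bot :: long_ray}))"
    unfolding connectedin_PiE by (auto simp: connected_Iic)
  ultimately show ?thesis
    by (simp add: euclidean_product_topology)
qed

text \<open>Box points with all coordinates in \<open>grid\<close> are determined by their
  restriction to the finite set \<open>I\<close>, hence countable in number; approximation from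
  below makes them dense.\<close>

lemma long_box_eq_closure:
  assumes "finite I"
  shows "\<exists>Q. countable Q \<and> closure Q = long_box I a"
proof (intro exI conjI)
  define Q where "Q = {y \<in> long_box I a. \<forall>i. y i \<in> grid}"
  have "Q \<subseteq> (\<lambda>y i. if i \<in> I then y i else bot) ` PiE I (\<lambda>_. grid \<inter> {..a})"
  proof
    fix y assume y: "y \<in> Q"
    have "y = (\<lambda>i. if i \<in> I then restrict y I i else bot)"
    proof
      fix i
      show "y i = (if i \<in> I then restrict y I i else bot)"
        using y unfolding Q_def long_box_def
        by (cases "i \<in> I") (force simp: bot_unique dest: spec[of _ i])+
    qed
    moreover have "restrict y I \<in> PiE I (\<lambda>_. grid \<inter> {..a})"
      using y by (auto simp: Q_def long_box_def split: if_splits)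
    ultimately show "y \<in> (\<lambda>y i. if i \<in> I then y i else bot) ` PiE I (\<lambda>_. grid \<inter> {..a})"
      by blast
  qed
  then show "countable Q"
    by (rule countable_subset) (intro countable_image countable_PiE assms countable_grid)
  show "closure Q = long_box I a"
  proof
    show "closure Q \<subseteq> long_box I a"
      by (rule closure_minimal) (auto simp: Q_def closed_long_box)
    show "long_box I a \<subseteq> closure Q"
    proof
      fix y assume y: "y \<in> long_box I a"
      have "\<forall>i. \<exists>d. (\<forall>k::nat. d k \<in> grid \<and> d k \<le> y i) \<and> d \<longlonglongrightarrow> y i"
        using grid_approximation by blast
      from choice[OF this]
      obtain d where d: "\<And>i k. d i k \<in> grid \<and> d i k \<le> y i" "\<And>i. (d i :: nat \<Rightarrow> _) \<longlonglongrightarrow> y i"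
        by blast
      have "d i k \<le> (if i \<in> I then a else bot)" for i k
        by (rule order_trans[of _ "y i"]) (use y d(1) in \<open>auto simp: long_box_def\<close>)
      then have "(\<lambda>i. d i k) \<in> Q" for k
        using d(1) by (simp add: Q_def long_box_def)
      then have "(\<lambda>i. d i k) \<in> closure Q" for k
        using closure_subset by blast
      moreover have "(\<lambda>k i. d i k) \<longlonglongrightarrow> y"
        using d(2) by (rule tendsto_coordinatewiseI)
      ultimately show "y \<in> closure Q"
        by (intro Lim_in_closed_set[of _ "\<lambda>k i. d i k" sequentially]) auto
    qed
  qed
qed

section \<open>Maps on powers of the ray\<close>

text \<open>Conditions that persist upward hold together at any point above the finitely many
  individual bounds.\<close>

lemma long_ray_uniform_bound:
  fixes P :: "'k \<Rightarrow> long_ray \<Rightarrow> bool"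
  assumes "finite K" "\<And>k. k \<in> K \<Longrightarrow> \<exists>b. P k b" "\<And>k b b'. P k b \<Longrightarrow> b \<le> b' \<Longrightarrow> P k b'"
  shows "\<exists>b>a. \<forall>k\<in>K. P k b"
proof -
  obtain B where B: "\<And>k. k \<in> K \<Longrightarrow> P k (B k)"
    using assms(2) by metis
  obtain b where "\<And>x. x \<in> insert a (B ` K) \<Longrightarrow> x < b"
    using countable_imp_strictly_bounded[of "insert a (B ` K)"] assms(1)
    by (auto simp: countable_finite)
  then have "a < b" "\<And>k. k \<in> K \<Longrightarrow> B k \<le> b"
    by (auto intro: less_imp_le)
  with B assms(3) show ?thesis by blast
qed

definition ray_map :: "('i \<Rightarrow> long_ray) \<Rightarrow> 'i set \<Rightarrow> long_ray \<Rightarrow> 'i \<Rightarrow> long_ray"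
  where "ray_map y T c = (\<lambda>i. if i \<in> T then c else y i)"

definition unbounded_faces :: "'i set \<Rightarrow> (('i \<Rightarrow> long_ray) \<Rightarrow> long_ray) \<Rightarrow> 'i set set"
  where "unbounded_faces I g = {T. T \<subseteq> I \<and> \<not> bdd_above (range (\<lambda>c. g (ray_map bot T c)))}"

text \<open>Total functions allow the topology of the function type to be used directly. By
  \<open>determined\<close> they are in effect maps on the power indexed by
  \<open>I\<close>.\<close>

locale finitely_determined =
  fixes I :: "'i set" and g :: "('i \<Rightarrow> long_ray) \<Rightarrow> long_ray"
  assumes finite_I: "finite I"
    and continuous: "continuous_on UNIV g"
    and determined: "(\<And>i. i \<in> I \<Longrightarrow> x i = y i) \<Longrightarrow> g x = g y"
begin

lemma value_tendsto:
  assumes "\<And>i. i \<in> I \<Longrightarrow> (\<lambda>k. F k i) \<longlonglongrightarrow> x i"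
  shows "(\<lambda>k. g (F k)) \<longlonglongrightarrow> g x"
proof -
  \<comment> \<open>Off \<open>I\<close> the sequence is replaced by the coordinates of the limit,
    which does not change the values of \<open>g\<close>.\<close>
  let ?F = "\<lambda>k i. if i \<in> I then F k i else x i"
  have "?F \<longlonglongrightarrow> x"
  proof (rule tendsto_coordinatewiseI)
    fix i
    show "(\<lambda>k. ?F k i) \<longlonglongrightarrow> x i"
      using assms by (cases "i \<in> I") simp_all
  qed
  then have "(\<lambda>k. g (?F k)) \<longlonglongrightarrow> g x"
    using continuous_on_tendsto_compose[OF continuous, of ?F x sequentially] by simp
  also have "(\<lambda>k. g (?F k)) = (\<lambda>k. g (F k))"
    by (intro ext determined) simp
  finally show ?thesis .
qed

text \<open>The starting points \<open>y\<close> in a box serve as parameters of a separable family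
  of maps, so the behaviour from \<open>bot\<close> decides that from every
  \<open>y\<close>.\<close>

lemma unbounded_on_rays:
  "if bdd_above (range (\<lambda>c. g (ray_map bot T c)))
    then \<exists>b. \<forall>y\<in>long_box I a. \<forall>c. g (ray_map y T c) \<le> b
    else club {c. \<forall>y\<in>long_box I a. g (ray_map y T c) = c}"
proof -
  obtain Q where Q: "countable Q" "closure Q = long_box I a"
    using long_box_eq_closure[OF finite_I] by blast
  have bot: "bot \<in> long_box I a"
    by (simp add: long_box_def)
  have c1: "continuous_on UNIV (\<lambda>c. g (ray_map y T c))" for y
  proof (rule continuous_on_compose2[OF continuous continuous_on_coordinatewise_then_product])
    show "continuous_on UNIV (\<lambda>c. ray_map y T c i)" for i
      by (cases "i \<in> T") (simp_all add: ray_map_def)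
  qed simp
  have c2: "continuous_on S (\<lambda>y. g (ray_map y T c))" for c S
  proof (rule continuous_on_compose2[OF continuous continuous_on_coordinatewise_then_product])
    have "continuous_on S (\<lambda>y. y i)" for i
      by (rule continuous_on_subset[OF continuous_on_product_coordinates]) simp
    then show "continuous_on S (\<lambda>y. ray_map y T c i)" for i
      by (cases "i \<in> T") (simp_all add: ray_map_def)
  qed simp
  show ?thesis
    using unbounded_in_separable_family[of Q "\<lambda>y c. g (ray_map y T c)" bot]
    unfolding Q(2) using Q(1) bot c1 c2 connected_long_box by blast
qed

text \<open>A failure gives points whose coordinates on \<open>T\<close> tend to some
  \<open>c > a\<close> while \<open>g\<close> stays below \<open>a\<close>. The chain is chosen so
  that \<open>c\<close> is also fixed on the rays over \<open>T\<close> from all boxes of size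
  \<open>X m\<close>. This forces the value \<open>c\<close> at a limit of the points, where
  \<open>g\<close> is at most \<open>a\<close>.\<close>

lemma tends_to_infinity_above_unbounded_face:
  assumes "T \<in> unbounded_faces I g"
  shows "\<exists>b. \<forall>x. (\<forall>i\<in>T. b \<le> x i) \<longrightarrow> a \<le> g x"
proof (rule ccontr)
  assume neg: "\<nexists>b. \<forall>x. (\<forall>i\<in>T. b \<le> x i) \<longrightarrow> a \<le> g x"
  define E where "E u = {c. \<forall>y\<in>long_box I u. g (ray_map y T c) = c}" for u
  have club_E: "club (E u)" for u
    using unbounded_on_rays[of T u] assms by (simp add: unbounded_faces_def E_def)
  define R where "R = (\<lambda>u v. (\<exists>x. (\<forall>i\<in>I. x i \<le> v) \<and> (\<forall>i\<in>T. u \<le> x i) \<and> g x < a) \<and> (\<exists>z\<in>E u. u < z \<and> z \<le> v))"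
  have "\<exists>v>u. R u v" for u
  proof -
    obtain x where x: "\<forall>i\<in>T. u \<le> x i" "g x < a"
      using neg by (meson not_le)
    obtain z where z: "z \<in> E u" "u < z"
      using club_E unfolding club_def by blast
    have "\<exists>v>z. \<forall>i\<in>I. x i \<le> v"
      by (rule long_ray_uniform_bound[OF finite_I]) auto
    then obtain v where "z < v" "\<forall>i\<in>I. x i \<le> v" by blast
    with x z show ?thesis
      unfolding R_def by (meson less_imp_le less_trans)
  qed
  then obtain X c where X: "X 0 = a" "\<And>m. R (X m) (X (Suc m))" "X \<longlonglongrightarrow> c"
    "\<And>m. X m < c" "incseq X"
    by (rule closing_off_chain[of R a]) (rule that)
  note step = X(2)[unfolded R_def]
  have E_X: "c \<in> E (X m)" for m
  proof -
    have "\<forall>k. \<exists>z. z \<in> E (X k) \<and> X k < z \<and> z \<le> X (Suc k)"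
      using step by blast
    from choice[OF this]
    obtain z where z: "\<And>k. z k \<in> E (X k) \<and> X k < z k \<and> z k \<le> X (Suc k)"
      by blast
    have "z \<longlonglongrightarrow> c"
      by (rule tendsto_sandwich[OF _ _ X(3) LIMSEQ_Suc[OF X(3)]])
        (use z in \<open>auto intro: always_eventually less_imp_le\<close>)
    \<comment> \<open>\<open>E\<close> shrinks as the box grows, so the closed set
      \<open>E (X m)\<close> contains a tail of \<open>z\<close>.\<close>
    have "z k \<in> E (X m)" if "m \<le> k" for k
    proof -
      have "X m \<le> X k" using X(5) that by (simp add: incseq_def)
      then have "long_box I (X m) \<subseteq> long_box I (X k)"
        by (auto simp: long_box_def intro: order_trans split: if_splits)
      then show ?thesis using z[of k] by (auto simp: E_def)
    qed
    then show ?thesis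
      using \<open>z \<longlonglongrightarrow> c\<close> club_E[of "X m"]
      by (intro Lim_in_closed_set[of _ z sequentially])
        (auto simp: club_def eventually_sequentially)
  qed
  \<comment> \<open>Cutting the coordinates at \<open>X m\<close> gives a starting point in a box on
    whose rays \<open>c\<close> is fixed; letting \<open>m\<close> grow recovers
    \<open>x\<close>.\<close>
  have fixed: "g x = c" if x: "\<And>i. i \<in> I \<Longrightarrow> x i \<le> c" "\<And>i. i \<in> T \<Longrightarrow> x i = c" for x
  proof -
    let ?y = "\<lambda>m i. if i \<in> I then min (x i) (X m) else bot"
    have "g (ray_map (?y m) T c) = c" for m
      using E_X[of m] by (auto simp: E_def long_box_def)
    moreover have "(\<lambda>m. g (ray_map (?y m) T c)) \<longlonglongrightarrow> g x"
    proof (rule value_tendsto)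
      fix i assume "i \<in> I"
      have "(\<lambda>m. min (x i) (X m)) \<longlonglongrightarrow> min (x i) c"
        by (intro tendsto_min tendsto_const X(3))
      then show "(\<lambda>m. ray_map (?y m) T c i) \<longlonglongrightarrow> x i"
        using x \<open>i \<in> I\<close> by (cases "i \<in> T") (simp_all add: ray_map_def min_absorb1)
    qed
    ultimately show ?thesis by (simp add: LIMSEQ_const_iff)
  qed
  have "\<forall>m. \<exists>x. (\<forall>i\<in>I. x i \<le> X (Suc m)) \<and> (\<forall>i\<in>T. X m \<le> x i) \<and> g x < a"
    using step by blast
  from choice[OF this]
  obtain x where x: "\<And>m i. i \<in> I \<Longrightarrow> x m i \<le> X (Suc m)" "\<And>m i. i \<in> T \<Longrightarrow> X m \<le> x m i"
    "\<And>m. g (x m) < a"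
    by blast
  obtain r y where r: "strict_mono r" "\<And>i. i \<in> I \<Longrightarrow> (\<lambda>k. x (r k) i) \<longlonglongrightarrow> y i"
    using finite_coordinates_converging_subsequence[OF finite_I, of x] by blast
  have "T \<subseteq> I" using assms by (simp add: unbounded_faces_def)
  have "y i = c" if "i \<in> T" for i
  proof -
    have "(\<lambda>m. x m i) \<longlonglongrightarrow> c"
      by (rule tendsto_sandwich[OF _ _ X(3) LIMSEQ_Suc[OF X(3)]])
        (use x that \<open>T \<subseteq> I\<close> in \<open>auto intro: always_eventually\<close>)
    from LIMSEQ_subseq_LIMSEQ[OF this r(1)]
    have "(\<lambda>k. x (r k) i) \<longlonglongrightarrow> c" by (simp add: o_def)
    moreover have "i \<in> I" using that \<open>T \<subseteq> I\<close> by blast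
    ultimately show ?thesis using r(2) LIMSEQ_unique by blast
  qed
  moreover have "y i \<le> c" if "i \<in> I" for i
  proof (rule LIMSEQ_le_const2[OF r(2)[OF that]])
    show "\<exists>N. \<forall>n\<ge>N. x (r n) i \<le> c"
      using x(1)[OF that] X(4) by (meson less_imp_le order_trans)
  qed
  ultimately have "g y = c" by (rule fixed[rotated])
  moreover have "g y \<le> a"
  proof (rule LIMSEQ_le_const2)
    show "(\<lambda>k. g (x (r k))) \<longlonglongrightarrow> g y" using r(2) by (rule value_tendsto)
    show "\<exists>N. \<forall>n\<ge>N. g (x (r n)) \<le> a" using x(3) by (meson less_imp_le)
  qed
  moreover have "a < c" using X(1) X(4)[of 0] by simp
  ultimately show False by simp
qed

text \<open>On the ray over \<open>T\<close> all coordinates in \<open>S\<close> grow too, so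
  \<open>tends_to_infinity_above_unbounded_face\<close> applies.\<close>

lemma unbounded_faces_upward_closed:
  assumes "S \<in> unbounded_faces I g" "S \<subseteq> T" "T \<subseteq> I"
  shows "T \<in> unbounded_faces I g"
proof -
  have "\<exists>c. a \<le> g (ray_map bot T c)" for a
    using tends_to_infinity_above_unbounded_face[OF assms(1), of a] assms(2)
    by (metis (no_types, lifting) order_refl ray_map_def subsetD)
  then have "\<not> bdd_above (range (\<lambda>c. g (ray_map bot T c)))"
    unfolding bdd_above_def by (metis gt_ex leD order_trans rangeI)
  with assms(3) show ?thesis by (simp add: unbounded_faces_def)
qed

text \<open>By induction and upward closure, \<open>g\<close> is bounded once the coordinates off
  \<open>T\<close> and a single one in \<open>T\<close> are. Large values thus force all coordinates
  in \<open>T\<close> up together, and in the limit they would exceed the bound on rays over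
  \<open>T\<close>.\<close>

lemma bounded_off_bounded_face:
  assumes "T \<subseteq> I" "T \<notin> unbounded_faces I g"
  shows "\<exists>b. \<forall>x. (\<forall>i\<in>I - T. x i \<le> a) \<longrightarrow> g x \<le> b"
proof -
  have "finite T" using assms(1) finite_I finite_subset by blast
  then show ?thesis
    using assms
  proof (induction T arbitrary: a rule: finite_psubset_induct)
    case (psubset T)
    have IH: "\<exists>b. \<forall>x. (\<forall>j\<in>I - (T - {i}). x j \<le> a') \<longrightarrow> g x \<le> b" if "i \<in> T" for i a'
      using psubset.IH[of "T - {i}"] that psubset.prems unbounded_faces_upward_closed[of "T - {i}" T]
      by blast
    show ?case
    proof (rule ccontr)
      assume neg: "\<nexists>b. \<forall>x. (\<forall>i\<in>I - T. x i \<le> a) \<longrightarrow> g x \<le> b"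
      have "bdd_above (range (\<lambda>c. g (ray_map bot T c)))"
        using psubset.prems by (simp add: unbounded_faces_def)
      \<comment> \<open>One bound serves all rays over \<open>T\<close> from the box of size
        \<open>a\<close>. The chain below starts at \<open>B\<close>, so its limit exceeds
        it.\<close>
      then obtain B where B: "\<And>y c. y \<in> long_box I a \<Longrightarrow> g (ray_map y T c) \<le> B"
        using unbounded_on_rays[of T a] by auto
      \<comment> \<open>Confining the coordinates on \<open>T\<close> and the value of
        \<open>g\<close> to the same interval makes both converge to the limit of the chain.\<close>
      define S where "S = (\<lambda>u v x. (\<forall>i\<in>I - T. x i \<le> a) \<and> (\<forall>i\<in>T. u \<le> x i \<and> x i \<le> v) \<and> u \<le> g x \<and> g x \<le> v)"
      have "\<exists>v>u. \<exists>x. S u v x" for u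
      proof -
        have "\<exists>b>u. \<forall>i\<in>T. \<forall>x. (\<forall>j\<in>I - (T - {i}). x j \<le> max a u) \<longrightarrow> g x \<le> b"
          by (rule long_ray_uniform_bound[OF \<open>finite T\<close> IH]) (auto intro: order_trans)
        then obtain b where b: "u < b"
          "\<And>i x. i \<in> T \<Longrightarrow> (\<And>j. j \<in> I - (T - {i}) \<Longrightarrow> x j \<le> max a u) \<Longrightarrow> g x \<le> b"
          by blast
        obtain x where x: "\<forall>i\<in>I - T. x i \<le> a" "b < g x"
          using neg by (meson not_le)
        have "u \<le> x i" if "i \<in> T" for i
        proof (rule ccontr)
          assume "\<not> u \<le> x i"
          then have "g x \<le> b"
            using x(1) by (intro b(2)[OF that]) (auto simp: le_max_iff_disj)
          with x(2) show False by simp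
        qed
        moreover have "\<exists>v>max u (g x). \<forall>i\<in>T. x i \<le> v"
          by (rule long_ray_uniform_bound[OF \<open>finite T\<close>]) auto
        then obtain v where "max u (g x) < v" "\<forall>i\<in>T. x i \<le> v" by blast
        ultimately have "S u v x" "u < v"
          using x b(1) by (auto simp: S_def)
        then show ?thesis by blast
      qed
      then obtain X c where X: "X 0 = B" "\<And>m. \<exists>x. S (X m) (X (Suc m)) x" "X \<longlonglongrightarrow> c"
    "\<And>m. X m < c" "incseq X"
        by (rule closing_off_chain[of "\<lambda>u v. \<exists>x. S u v x" B]) (rule that)
      have "\<forall>m. \<exists>x. S (X m) (X (Suc m)) x" using X(2) ..
      from choice[OF this]
      obtain x where x: "\<And>m. S (X m) (X (Suc m)) (x m)"
        by blast
      note x = x[unfolded S_def]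
      obtain r y where r: "strict_mono r" "\<And>i. i \<in> I \<Longrightarrow> (\<lambda>k. x (r k) i) \<longlonglongrightarrow> y i"
        using finite_coordinates_converging_subsequence[OF finite_I, of x] by blast
      note squeeze = tendsto_sandwich[OF _ _ X(3) LIMSEQ_Suc[OF X(3)]]
      have "y i = c" if "i \<in> T" for i
      proof -
        have "(\<lambda>m. x m i) \<longlonglongrightarrow> c"
          by (rule squeeze) (use x that in \<open>auto intro: always_eventually\<close>)
        from LIMSEQ_subseq_LIMSEQ[OF this r(1)]
        have "(\<lambda>k. x (r k) i) \<longlonglongrightarrow> c" by (simp add: o_def)
        moreover have "i \<in> I" using that psubset.prems(1) by blast
        ultimately show ?thesis using r(2) LIMSEQ_unique by blast
      qed
      moreover have "y i \<le> a" if "i \<in> I - T" for i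
        using LIMSEQ_le_const2[OF r(2)] x that by blast
      ultimately have "g y = g (ray_map (\<lambda>i. if i \<in> I - T then y i else bot) T c)"
        "(\<lambda>i. if i \<in> I - T then y i else bot) \<in> long_box I a"
        by (auto intro!: determined simp: ray_map_def long_box_def)
      then have "g y \<le> B" using B by simp
      have "(\<lambda>m. g (x m)) \<longlonglongrightarrow> c"
        by (rule squeeze) (use x in \<open>auto intro: always_eventually\<close>)
      then have "(\<lambda>k. g (x (r k))) \<longlonglongrightarrow> c"
        using LIMSEQ_subseq_LIMSEQ[OF _ r(1)] by (auto simp: o_def)
      then have "g y = c"
        using value_tendsto[of "\<lambda>k. x (r k)" y, OF r(2)] LIMSEQ_unique by blast
      then show False
        using \<open>g y \<le> B\<close> X(1) X(4)[of 0] by simp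
    qed
  qed
qed

text \<open>\<open>R u v\<close> collects the two preceding bounds for all faces at once, with
  \<open>v\<close> answering \<open>u\<close>. At the limit of a chain both merge into the single
  level \<open>c\<close>.\<close>

lemma separating_levels_unbounded:
  "\<exists>c>a. (\<forall>x. \<forall>T\<in>unbounded_faces I g. (\<forall>i\<in>T. c \<le> x i) \<longrightarrow> c \<le> g x) \<and>
    (\<forall>x. \<forall>T\<in>Pow I - unbounded_faces I g. (\<forall>i\<in>I - T. x i \<le> c) \<longrightarrow> g x \<le> c)"
proof -
  let ?U = "unbounded_faces I g"
  define R where "R = (\<lambda>u v. (\<forall>T\<in>?U. \<forall>x. (\<forall>i\<in>T. v \<le> x i) \<longrightarrow> u \<le> g x) \<and>
    (\<forall>T\<in>Pow I - ?U. \<forall>x. (\<forall>i\<in>I - T. x i \<le> u) \<longrightarrow> g x \<le> v))"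
  have "finite ?U"
    using finite_I by (auto simp: unbounded_faces_def intro: finite_subset[of _ "Pow I"])
  have "\<exists>v>u. R u v" for u
  proof -
    have "\<exists>v>u. \<forall>T\<in>?U. \<forall>x. (\<forall>i\<in>T. v \<le> x i) \<longrightarrow> u \<le> g x"
      by (rule long_ray_uniform_bound[OF \<open>finite ?U\<close> tends_to_infinity_above_unbounded_face])
        (auto dest: order_trans)
    then obtain v where v: "u < v" "\<forall>T\<in>?U. \<forall>x. (\<forall>i\<in>T. v \<le> x i) \<longrightarrow> u \<le> g x"
      by blast
    have "\<exists>w>v. \<forall>T\<in>Pow I - ?U. \<forall>x. (\<forall>i\<in>I - T. x i \<le> u) \<longrightarrow> g x \<le> w"
      using finite_I
      by (intro long_ray_uniform_bound) (auto intro: bounded_off_bounded_face order_trans)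
    then obtain w where "v < w" and w: "\<forall>T\<in>Pow I - ?U. \<forall>x. (\<forall>i\<in>I - T. x i \<le> u) \<longrightarrow> g x \<le> w"
      by blast
    moreover have "u \<le> g x" if "T \<in> ?U" "\<forall>i\<in>T. w \<le> x i" for T x
      using v(2) that \<open>v < w\<close> by (meson less_imp_le order_trans)
    ultimately have "R u w" "u < w"
      using v(1) \<open>v < w\<close> w by (auto simp: R_def)
    then show ?thesis by blast
  qed
  then obtain X c where X: "X 0 = a" "\<And>m. R (X m) (X (Suc m))" "X \<longlonglongrightarrow> c"
    "\<And>m. X m < c" "incseq X"
    by (rule closing_off_chain[of R a]) (rule that)
  note step = X(2)[unfolded R_def]
  have "c \<le> g x" if "T \<in> ?U" "\<forall>i\<in>T. c \<le> x i" for T x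
  proof -
    have "X m \<le> g x" for m
      using step[of m] that X(4)[of "Suc m"] by (meson less_imp_le order_trans)
    then show ?thesis using X(3) by (intro LIMSEQ_le_const2[OF X(3)]) auto
  qed
  moreover have "g x \<le> c" if "T \<in> Pow I - ?U" "\<forall>i\<in>I - T. x i \<le> c" for T x
  proof -
    \<comment> \<open>Off \<open>T\<close> the coordinates are cut at \<open>X m\<close> so that the
      bound for \<open>X m\<close> applies; being at most \<open>c\<close>, they are restored in the
      limit.\<close>
    let ?x = "\<lambda>m i. if i \<in> T then x i else min (x i) (X m)"
    have "(\<lambda>m. g (?x m)) \<longlonglongrightarrow> g x"
    proof (rule value_tendsto)
      fix i assume "i \<in> I"
      have "(\<lambda>m. min (x i) (X m)) \<longlonglongrightarrow> min (x i) c"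
        by (intro tendsto_min tendsto_const X(3))
      then show "(\<lambda>m. ?x m i) \<longlonglongrightarrow> x i"
        using that \<open>i \<in> I\<close> by (cases "i \<in> T") (simp_all add: min_absorb1)
    qed
    moreover have "g (?x m) \<le> c" for m
    proof -
      have "g (?x m) \<le> X (Suc m)"
        using step[THEN conjunct2, rule_format, OF that(1), of "?x m" m] by simp
      then show ?thesis using X(4)[of "Suc m"] by simp
    qed
    ultimately show ?thesis by (intro LIMSEQ_le_const2) auto
  qed
  moreover have "a < c" using X(1) X(4)[of 0] by simp
  ultimately show ?thesis by blast
qed

end

section \<open>Homotopies between unseparated maps\<close>

text \<open>Summing weights \<open>(1 / 2) ^ k\<close> over the \<open>grid\<close> points below
  \<open>x\<close> gives a strictly increasing real function \<open>s\<close> on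
  \<open>{..q}\<close>. It may jump, but its monotone generalised inverse \<open>\<gamma>\<close>
  takes every value up to \<open>q\<close> and is therefore continuous.\<close>

lemma long_ray_path_exists:
  "\<exists>\<gamma> :: real \<Rightarrow> long_ray. continuous_on UNIV \<gamma> \<and> \<gamma> 0 = bot \<and> \<gamma> 1 = q"
proof -
  define d where "d = from_nat_into (grid \<inter> {..q})"
  have d: "range d = grid \<inter> {..q}"
    unfolding d_def using bot_in_grid by (intro range_from_nat_into countable_grid) auto
  define w where "w x k = (if d k < x then (1 / 2) ^ k else 0 :: real)" for x k
  have w_summable: "summable (w x)" for x
    by (rule summable_comparison_test'[of "\<lambda>k. (1 / 2) ^ k" 0])
      (auto simp: w_def intro!: summable_geometric)
  define s where "s x = (\<Sum>k. w x k)" for x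
  have s_less: "s x < s y" if xy: "x < y" "y \<le> q" for x y
  proof -
    obtain e where "e \<in> grid" "x \<le> e" "e < y"
      using grid_dense[OF xy(1)] by blast
    then have "e \<in> range d" using d xy(2) by auto
    then obtain k where k: "x \<le> d k" "d k < y"
      using \<open>x \<le> e\<close> \<open>e < y\<close> by auto
    have "0 < (\<Sum>k. w y k - w x k)"
    proof (rule suminf_pos2)
      show "summable (\<lambda>k. w y k - w x k)"
        by (intro summable_diff w_summable)
      show "0 \<le> w y k - w x k" for k
        using xy(1) by (auto simp: w_def)
      show "0 < w y k - w x k"
        using k by (auto simp: w_def)
    qed
    also have "\<dots> = s y - s x"
      unfolding s_def by (rule suminf_diff[symmetric, OF w_summable w_summable])
    finally show ?thesis by simp
  qed
  have s_bot: "s bot = 0"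
    by (simp add: s_def w_def)
  have s_nonneg: "0 \<le> s x" for x
    unfolding s_def by (intro suminf_nonneg w_summable) (simp add: w_def)
  \<comment> \<open>With \<open>max t 0\<close> the set contains \<open>bot\<close> for negative
    \<open>t\<close> too, so \<open>\<gamma>\<close> is well behaved on the whole real line.\<close>
  define L where "L t = {x. x \<le> q \<and> s x \<le> max t 0}" for t
  define \<gamma> where "\<gamma> t = Sup (L t)" for t
  have L: "bot \<in> L t" "bdd_above (L t)" for t
    by (auto simp: L_def s_bot bdd_above_def)
  have \<gamma>_mono: "\<gamma> t \<le> \<gamma> t'" if "t \<le> t'" for t t'
  proof -
    have "L t \<subseteq> L t'" using that by (auto simp: L_def)
    moreover have "L t \<noteq> {}" using L(1) by blast
    ultimately show ?thesis unfolding \<gamma>_def by (intro cSup_subset_mono L(2))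
  qed
  have \<gamma>_le: "\<gamma> t \<le> q" for t
  proof -
    have "L t \<noteq> {}" using L(1) by blast
    then show ?thesis unfolding \<gamma>_def by (rule cSup_least) (simp add: L_def)
  qed
  have \<gamma>_s: "\<gamma> (s x) = x" if "x \<le> q" for x
    unfolding \<gamma>_def
  proof (rule cSup_eq_maximum)
    show "x \<in> L (s x)" using that by (simp add: L_def)
    show "y \<le> x" if "y \<in> L (s x)" for y
    proof (rule ccontr)
      assume "\<not> y \<le> x"
      then have "s x < s y" using that by (intro s_less) (auto simp: L_def)
      then show False using that s_nonneg[of x] by (simp add: L_def)
    qed
  qed
  have \<gamma>_isCont: "isCont \<gamma> t" for t
    unfolding isCont_def
  proof (rule order_tendstoI)
    fix a assume "a < \<gamma> t"
    then obtain z where z: "a < z" "z < \<gamma> t" using dense by blast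
    then have "z \<le> q" using \<gamma>_le[of t] by simp
    have "s z < t"
      using \<gamma>_mono[of t "s z"] z(2) \<gamma>_s[OF \<open>z \<le> q\<close>] by (cases "s z < t") auto
    then have "\<forall>\<^sub>F t' in at t. s z < t'"
      by (rule order_tendstoD(1)[OF tendsto_ident_at])
    then show "\<forall>\<^sub>F t' in at t. a < \<gamma> t'"
    proof eventually_elim
      case (elim t')
      then show ?case using \<gamma>_mono[of "s z" t'] \<gamma>_s[OF \<open>z \<le> q\<close>] z(1) by simp
    qed
  next
    fix a assume "\<gamma> t < a"
    show "\<forall>\<^sub>F t' in at t. \<gamma> t' < a"
    proof (cases "q < a")
      case True
      then show ?thesis using \<gamma>_le le_less_trans by (blast intro: always_eventually)
    next
      case False
      obtain z where z: "\<gamma> t < z" "z < a" using \<open>\<gamma> t < a\<close> dense by blast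
      then have "z \<le> q" using False by simp
      have "t < s z"
        using \<gamma>_mono[of "s z" t] z(1) \<gamma>_s[OF \<open>z \<le> q\<close>] by (cases "t < s z") auto
      then have "\<forall>\<^sub>F t' in at t. t' < s z"
        by (rule order_tendstoD(2)[OF tendsto_ident_at])
      then show ?thesis
      proof eventually_elim
        case (elim t')
        then show ?case using \<gamma>_mono[of t' "s z"] \<gamma>_s[OF \<open>z \<le> q\<close>] z(2) by simp
      qed
    qed
  qed
  have "continuous_on UNIV \<gamma>"
    by (simp add: continuous_on_eq_continuous_at \<gamma>_isCont)
  \<comment> \<open>Rescaling makes the path arrive at time 1.\<close>
  moreover have "continuous_on UNIV (\<lambda>t. t * s q)"
    by (intro continuous_intros)
  ultimately have "continuous_on UNIV (\<lambda>t. \<gamma> (t * s q))"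
    by (rule continuous_on_compose2) simp
  moreover have "\<gamma> (0 * s q) = bot" "\<gamma> (1 * s q) = q"
    using \<gamma>_s[of bot] \<gamma>_s[of q] by (simp_all add: s_bot)
  ultimately show ?thesis by blast
qed

text \<open>A path from \<open>bot\<close> to a point at or above \<open>v\<close> is clipped to the
  segment from \<open>u\<close> to \<open>v\<close>. Continuity follows by squeezing where
  \<open>u = v\<close>; elsewhere the end of the path is locally constant.\<close>

lemma continuous_between_unseparated:
  fixes C :: "long_ray set"
  assumes "\<And>a. \<exists>c\<in>C. a < c"
  defines "E \<equiv> {(u, v). u \<le> v \<and> (\<forall>c\<in>C. \<not> (u < c \<and> c < v))}"
  shows "\<exists>K :: real \<times> long_ray \<times> long_ray \<Rightarrow> long_ray. continuous_on (UNIV \<times> E) K \<and>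
    (\<forall>u v. (u, v) \<in> E \<longrightarrow> K (0, u, v) = u \<and> K (1, u, v) = v)"
proof -
  from choice[OF allI[OF long_ray_path_exists]]
  obtain \<gamma> :: "long_ray \<Rightarrow> real \<Rightarrow> long_ray" where
    "\<forall>q. continuous_on UNIV (\<gamma> q) \<and> \<gamma> q 0 = bot \<and> \<gamma> q 1 = q" ..
  then have \<gamma>: "continuous_on UNIV (\<gamma> q)" "\<gamma> q 0 = bot" "\<gamma> q 1 = q" for q
    by simp_all
  \<comment> \<open>The target is chosen as a function of the set of later points of \<open>C\<close>, so that it
    does not change while no point of \<open>C\<close> is crossed.\<close>
  define target where "target u = (SOME c. c \<in> C \<inter> {u<..})" for u
  have target: "target u \<in> C" "u < target u" for u
  proof -
    have "\<exists>c. c \<in> C \<inter> {u<..}" using assms(1)[of u] by auto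
    then have "target u \<in> C \<inter> {u<..}" unfolding target_def by (rule someI_ex)
    then show "target u \<in> C" "u < target u" by auto
  qed
  define K where "K = (\<lambda>(t, u, v). max u (min v (\<gamma> (target u) t)))"
  have K_ends: "K (0, u, v) = u \<and> K (1, u, v) = v" if "u \<le> v" "\<forall>c\<in>C. \<not> (u < c \<and> c < v)" for u v
  proof -
    have "v \<le> target u" using that(2) target[of u] by (meson not_le)
    then show ?thesis
      using that(1) by (simp add: K_def \<gamma> max_absorb2 min_absorb1 max_absorb1 min_absorb2)
  qed
  have "(K \<longlongrightarrow> K p) (at p within UNIV \<times> E)" if "p \<in> UNIV \<times> E" for p
  proof -
    obtain t\<^sub>0 u\<^sub>0 v\<^sub>0 where p: "p = (t\<^sub>0, u\<^sub>0, v\<^sub>0)" by (cases p) auto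
    have E: "u\<^sub>0 \<le> v\<^sub>0" using that by (simp add: p E_def)
    let ?F = "at p within UNIV \<times> E"
    have id: "((\<lambda>z. z) \<longlongrightarrow> p) ?F"
      by (rule tendsto_ident_at)
    have t: "((\<lambda>z. fst z) \<longlongrightarrow> t\<^sub>0) ?F"
      and u: "((\<lambda>z. fst (snd z)) \<longlongrightarrow> u\<^sub>0) ?F" and v: "((\<lambda>z. snd (snd z)) \<longlongrightarrow> v\<^sub>0) ?F"
      using tendsto_fst[OF id] tendsto_fst[OF tendsto_snd[OF id]] tendsto_snd[OF tendsto_snd[OF id]]
      by (simp_all add: p)
    have in_E: "\<forall>\<^sub>F z in ?F. z \<in> UNIV \<times> E"
      by (simp add: eventually_at_topological) (meson open_UNIV UNIV_I)
    show ?thesis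
    proof (cases "u\<^sub>0 = v\<^sub>0")
      case True
      have "K p = u\<^sub>0" using True by (simp add: p K_def max_absorb1)
      moreover have "(K \<longlongrightarrow> u\<^sub>0) ?F"
      proof (rule tendsto_sandwich[OF _ _ u v[folded True]])
        show "\<forall>\<^sub>F z in ?F. fst (snd z) \<le> K z" "\<forall>\<^sub>F z in ?F. K z \<le> snd (snd z)"
          using in_E by (eventually_elim; force simp: K_def E_def)+
      qed
      ultimately show ?thesis by simp
    next
      case False
      then have "u\<^sub>0 < v\<^sub>0" using E by simp
      \<comment> \<open>A point strictly inside the segment stays inside for nearby pairs, and these
        all share its target.\<close>
      then obtain w where w: "u\<^sub>0 < w" "w < v\<^sub>0" using dense by blast
      define k where "k = (\<lambda>z :: real \<times> long_ray \<times> long_ray.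
        max (fst (snd z)) (min (snd (snd z)) (\<gamma> (target w) (fst z))))"
      have agree: "K z = k z" if z: "z \<in> UNIV \<times> E" "fst (snd z) < w" "w < snd (snd z)" for z
      proof -
        obtain t' u' v' where z': "z = (t', u', v')" by (cases z) auto
        have "\<not> (u' < c \<and> c < v')" if "c \<in> C" for c
          using z(1) that by (auto simp: z' E_def)
        then have "C \<inter> {u'<..} = C \<inter> {w<..}"
          using z(2,3) by (auto simp: z') (meson le_less_trans not_le)
        then have "target u' = target w" by (simp add: target_def)
        then show ?thesis by (simp add: K_def k_def z')
      qed
      have "((\<lambda>z. \<gamma> (target w) (fst z)) \<longlongrightarrow> \<gamma> (target w) t\<^sub>0) ?F"
        by (rule continuous_on_tendsto_compose[OF \<gamma>(1) t]) auto
      then have "(k \<longlongrightarrow> max u\<^sub>0 (min v\<^sub>0 (\<gamma> (target w) t\<^sub>0))) ?F"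
        unfolding k_def by (intro tendsto_max tendsto_min u v)
      then have "(k \<longlongrightarrow> k p) ?F"
        by (simp add: k_def p)
      moreover have "\<forall>\<^sub>F z in ?F. k z = K z"
        using in_E order_tendstoD(2)[OF u w(1)] order_tendstoD(1)[OF v w(2)]
        by eventually_elim (simp add: agree)
      moreover have "k p = K p"
        using agree[of p] that w by (simp add: p)
      ultimately show ?thesis
        using Lim_transform_eventually[of k "k p" ?F K] by simp
    qed
  qed
  then have "continuous_on (UNIV \<times> E) K"
    by (simp add: continuous_on_def)
  with K_ends show ?thesis by (intro exI[of _ K]) (auto simp: E_def)
qed

lemma homotopic_if_unseparated_le:
  fixes f g :: "'a \<Rightarrow> long_ray"
  assumes "continuous_map X euclidean f" "continuous_map X euclidean g"
    and le: "\<And>x. x \<in> topspace X \<Longrightarrow> f x \<le> g x"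
    and "\<And>a. \<exists>c\<in>C. a < c"
    and C: "\<And>x c. x \<in> topspace X \<Longrightarrow> c \<in> C \<Longrightarrow> \<not> (f x < c \<and> c < g x)"
  shows "homotopic_with (\<lambda>_. True) X euclidean f g"
proof -
  define E where "E = {(u, v). u \<le> v \<and> (\<forall>c\<in>C. \<not> (u < c \<and> c < v))}"
  from continuous_between_unseparated[of C, folded E_def, OF assms(4)]
  obtain K :: "real \<times> long_ray \<times> long_ray \<Rightarrow> long_ray" where
    K: "continuous_on (UNIV \<times> E) K \<and> (\<forall>u v. (u, v) \<in> E \<longrightarrow> K (0, u, v) = u \<and> K (1, u, v) = v)" ..
  let ?P = "prod_topology (top_of_set {0..1::real}) X"
  have "continuous_map ?P euclidean fst"
    using continuous_map_fst continuous_map_into_fulltopology by blast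
  moreover have "continuous_map ?P euclidean (\<lambda>z. f (snd z))" "continuous_map ?P euclidean (\<lambda>z. g (snd z))"
    using continuous_map_compose[OF continuous_map_snd assms(1)]
      continuous_map_compose[OF continuous_map_snd assms(2)] by (simp_all add: o_def)
  ultimately have "continuous_map ?P (prod_topology euclidean (prod_topology euclidean euclidean))
      (\<lambda>z. (fst z, f (snd z), g (snd z)))"
    by (intro continuous_map_pairedI)
  then have "continuous_map ?P (top_of_set (UNIV \<times> E)) (\<lambda>z. (fst z, f (snd z), g (snd z)))"
    using le C by (auto simp: continuous_map_in_subtopology E_def)
  from continuous_map_compose[OF this, of euclidean K] K
  have "continuous_map ?P euclidean (\<lambda>z. K (fst z, f (snd z), g (snd z)))"
    by (simp add: o_def)
  moreover have "K (0, f x, g x) = f x \<and> K (1, f x, g x) = g x" if "x \<in> topspace X" for x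
    using K le[OF that] C[OF that] by (auto simp: E_def)
  ultimately show ?thesis
    by (subst homotopic_with) (auto intro!: exI[of _ "\<lambda>z. K (fst z, f (snd z), g (snd z))"])
qed

text \<open>The pointwise maximum lies above both maps and is unseparated from each, so the ordered
  case applies twice.\<close>

lemma homotopic_if_unseparated:
  fixes f g :: "'a \<Rightarrow> long_ray"
  assumes f: "continuous_map X euclidean f" and g: "continuous_map X euclidean g"
    and unbounded: "\<And>a. \<exists>c\<in>C. a < c"
    and C: "\<And>x c. x \<in> topspace X \<Longrightarrow> c \<in> C \<Longrightarrow> \<not> (f x < c \<and> c < g x) \<and> \<not> (g x < c \<and> c < f x)"
  shows "homotopic_with (\<lambda>_. True) X euclidean f g"
proof -
  have "continuous_on UNIV (\<lambda>z :: long_ray \<times> long_ray. max (fst z) (snd z))"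
    by (intro continuous_intros)
  moreover have "continuous_map X euclidean (\<lambda>x. (f x, g x))"
    using continuous_map_pairedI[OF f g] by simp
  ultimately have max: "continuous_map X euclidean (\<lambda>x. max (f x) (g x))"
    using continuous_map_compose[of X euclidean "\<lambda>x. (f x, g x)" euclidean
        "\<lambda>z. max (fst z) (snd z)"] by (simp add: o_def)
  have "homotopic_with (\<lambda>_. True) X euclidean f (\<lambda>x. max (f x) (g x))"
    by (rule homotopic_if_unseparated_le[OF f max _ unbounded]) (use C in \<open>auto simp: less_max_iff_disj\<close>)
  moreover have "homotopic_with (\<lambda>_. True) X euclidean g (\<lambda>x. max (f x) (g x))"
    by (rule homotopic_if_unseparated_le[OF g max _ unbounded]) (use C in \<open>auto simp: less_max_iff_disj\<close>)
  ultimately show ?thesis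
    by (meson homotopic_with_sym homotopic_with_trans)
qed

section \<open>Classification by antichains\<close>

text \<open>Inserting \<open>bot\<close> also covers the empty antichain, which gives the constant
  map \<open>bot\<close>.\<close>

definition max_min :: "'i set set \<Rightarrow> ('i \<Rightarrow> long_ray) \<Rightarrow> long_ray"
  where "max_min A x = Max (insert bot ((\<lambda>S. Min (x ` S)) ` A))"

lemma le_max_min_iff:
  assumes "finite A" "\<And>S. S \<in> A \<Longrightarrow> finite S \<and> S \<noteq> {}"
  shows "c \<le> max_min A x \<longleftrightarrow> c = bot \<or> (\<exists>S\<in>A. \<forall>i\<in>S. c \<le> x i)"
proof -
  have "c \<le> Min (x ` S) \<longleftrightarrow> (\<forall>i\<in>S. c \<le> x i)" if "S \<in> A" for S
    using assms(2)[OF that] by (subst Min_ge_iff) auto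
  moreover have "c \<le> max_min A x \<longleftrightarrow> c \<le> bot \<or> (\<exists>S\<in>A. c \<le> Min (x ` S))"
    unfolding max_min_def using assms(1) by (subst Max_ge_iff) auto
  ultimately show ?thesis by (simp add: bot_unique)
qed

lemma continuous_on_Min_coordinates:
  assumes "finite S" "S \<noteq> {}"
  shows "continuous_on UNIV (\<lambda>x :: 'i \<Rightarrow> long_ray. Min (x ` S))"
  using assms
proof (induction rule: finite_ne_induct)
  case (insert i S)
  then have eq: "(\<lambda>x :: 'i \<Rightarrow> long_ray. Min (x ` insert i S)) = (\<lambda>x. min (x i) (Min (x ` S)))"
    by (simp add: fun_eq_iff)
  show ?case
    unfolding eq using insert.IH by (intro continuous_on_min) auto
qed simp

lemma continuous_on_max_min:
  assumes "finite A" "\<And>S. S \<in> A \<Longrightarrow> finite S \<and> S \<noteq> {}"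
  shows "continuous_on UNIV (max_min A)"
  using assms
proof (induction rule: finite_induct)
  case empty
  show ?case by (simp add: max_min_def[abs_def])
next
  case (insert S A)
  have "max_min (insert S A) x = max (Min (x ` S)) (max_min A x)" for x
  proof -
    have eq: "insert bot ((\<lambda>S. Min (x ` S)) ` insert S A) =
        insert (Min (x ` S)) (insert bot ((\<lambda>S. Min (x ` S)) ` A))"
      by auto
    show ?thesis
      unfolding max_min_def eq by (rule Max_insert) (use insert.hyps in auto)
  qed
  then have "max_min (insert S A) = (\<lambda>x. max (Min (x ` S)) (max_min A x))" ..
  with insert show ?case
    by (simp add: continuous_on_max continuous_on_Min_coordinates)
qed

lemma antichains_finite:
  assumes "finite I" "A \<in> antichains (Pow I - {{}})"
  shows "finite A" "S \<in> A \<Longrightarrow> finite S \<and> S \<noteq> {}"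
proof -
  have "A \<subseteq> Pow I - {{}}" using assms(2) by (simp add: antichains_def)
  with assms(1) show "finite A" "S \<in> A \<Longrightarrow> finite S \<and> S \<noteq> {}"
    by (auto intro: finite_subset)
qed

lemma finitely_determined_max_min:
  assumes "finite I" "A \<in> antichains (Pow I - {{}})"
  shows "finitely_determined I (max_min A)"
proof
  show "continuous_on UNIV (max_min A)"
    by (intro continuous_on_max_min antichains_finite[OF assms])
  fix x y :: "'a \<Rightarrow> long_ray" assume "\<And>i. i \<in> I \<Longrightarrow> x i = y i"
  then have "x ` S = y ` S" if "S \<in> A" for S
    using that assms(2) by (auto simp: antichains_def intro!: image_cong)
  then show "max_min A x = max_min A y"
    by (simp add: max_min_def cong: image_cong)
qed (rule assms(1))

text \<open>On the ray over \<open>T\<close>, a set \<open>S \<subseteq> T\<close> contributes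
  \<open>c\<close>, while any other \<open>S\<close> has a coordinate at \<open>bot\<close> and
  contributes only \<open>bot\<close>.\<close>

lemma unbounded_faces_max_min:
  assumes "finite I" "A \<in> antichains (Pow I - {{}})"
  shows "unbounded_faces I (max_min A) = {T. T \<subseteq> I \<and> (\<exists>S\<in>A. S \<subseteq> T)}"
proof -
  note le = le_max_min_iff[OF antichains_finite[OF assms]]
  have above: "\<not> bdd_above (range (\<lambda>c. max_min A (ray_map bot T c)))" if "S \<in> A" "S \<subseteq> T" for S T
  proof -
    have "c \<le> max_min A (ray_map bot T c)" for c
      using that le by (auto simp: ray_map_def)
    then show ?thesis
      unfolding bdd_above_def by (metis gt_ex leD order_trans rangeI)
  qed
  have not_above: "bdd_above (range (\<lambda>c. max_min A (ray_map bot T c)))" if none: "\<And>S. S \<in> A \<Longrightarrow> \<not> S \<subseteq> T" for T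
  proof -
    have "max_min A (ray_map bot T c) = bot" for c
    proof (rule ccontr)
      assume ne: "max_min A (ray_map bot T c) \<noteq> bot"
      then obtain S where S: "S \<in> A" "\<forall>i\<in>S. max_min A (ray_map bot T c) \<le> ray_map bot T c i"
        using le[of "max_min A (ray_map bot T c)" "ray_map bot T c"] by auto
      obtain i where "i \<in> S" "i \<notin> T" using none[OF \<open>S \<in> A\<close>] by blast
      with S(2) have "max_min A (ray_map bot T c) \<le> bot" by (auto simp: ray_map_def)
      with ne show False by (simp add: bot_unique)
    qed
    then show ?thesis by simp
  qed
  have "bdd_above (range (\<lambda>c. max_min A (ray_map bot T c))) \<longleftrightarrow> \<not> (\<exists>S\<in>A. S \<subseteq> T)" for T
    using above[of _ T] not_above[of T] by (cases "\<exists>S\<in>A. S \<subseteq> T") auto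
  then show ?thesis by (simp add: unbounded_faces_def)
qed

section \<open>Antichains and upward closed families\<close>

definition minimal_sets :: "'i set set \<Rightarrow> 'i set set"
  where "minimal_sets U = {S \<in> U. \<forall>T\<in>U. T \<subseteq> S \<longrightarrow> T = S}"

lemma minimal_sets_antichain:
  assumes "U \<subseteq> Pow I - {{}}"
  shows "minimal_sets U \<in> antichains (Pow I - {{}})"
  using assms by (auto simp: minimal_sets_def antichains_def pairwise_def)

text \<open>A minimal member contains a member of \<open>A\<close> and so equals it; members of
  \<open>A\<close> are minimal by incomparability. Thus the unbounded faces of
  \<open>max_min A\<close> determine \<open>A\<close>.\<close>

lemma minimal_sets_of_upset:
  assumes "A \<in> antichains (Pow I - {{}})"
  shows "minimal_sets {T. T \<subseteq> I \<and> (\<exists>S\<in>A. S \<subseteq> T)} = A"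
proof -
  have A: "\<And>S. S \<in> A \<Longrightarrow> S \<subseteq> I" "\<And>S T. S \<in> A \<Longrightarrow> T \<in> A \<Longrightarrow> S \<subseteq> T \<Longrightarrow> S = T"
    using assms by (auto simp: antichains_def pairwise_def)
  show ?thesis
  proof (intro equalityI subsetI)
    fix T assume T: "T \<in> minimal_sets {T. T \<subseteq> I \<and> (\<exists>S\<in>A. S \<subseteq> T)}"
    then obtain S where S: "S \<in> A" "S \<subseteq> T"
      by (auto simp: minimal_sets_def)
    then have "S = T"
      using T A(1)[OF S(1)] by (auto simp: minimal_sets_def)
    with S show "T \<in> A" by simp
  next
    fix S assume "S \<in> A"
    moreover have "T = S" if "R \<in> A" "R \<subseteq> T" "T \<subseteq> S" for R T
      using A(2)[OF that(1) \<open>S \<in> A\<close>] that by auto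
    ultimately show "S \<in> minimal_sets {T. T \<subseteq> I \<and> (\<exists>S\<in>A. S \<subseteq> T)}"
      using A(1) by (auto simp: minimal_sets_def)
  qed
qed

lemma minimal_set_below:
  assumes "finite U" "T \<in> U"
  shows "\<exists>S\<in>minimal_sets U. S \<subseteq> T"
  using finite_has_minimal2[OF assms] by (auto simp: minimal_sets_def)

section \<open>The product space and total functions\<close>

abbreviation (input) ray_power :: "'i set \<Rightarrow> ('i \<Rightarrow> long_ray) topology"
  where "ray_power I \<equiv> product_topology (\<lambda>_. euclidean) I"

lemma continuous_map_restrict: "continuous_map euclidean (ray_power I) (\<lambda>x. restrict x I)"
  by (auto simp: continuous_map_componentwise)

text \<open>Points of the product space are \<open>undefined\<close> off \<open>I\<close>, so those
  coordinates are constant and the inclusion into the full function space is continuous.\<close>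

lemma continuous_map_ray_power:
  assumes "continuous_on UNIV g"
  shows "continuous_map (ray_power I) euclidean g"
proof -
  have "continuous_map (ray_power I) (product_topology (\<lambda>_. euclidean) UNIV) (\<lambda>x. x)"
    unfolding continuous_map_componentwise_UNIV
  proof
    fix i
    show "continuous_map (ray_power I) euclidean (\<lambda>x. x i)"
    proof (cases "i \<in> I")
      case False
      show ?thesis
        by (rule continuous_map_eq[of _ _ "\<lambda>_. undefined"]) (use False in \<open>auto simp: PiE_def extensional_def\<close>)
    qed (rule continuous_map_product_projection)
  qed
  then have "continuous_map (ray_power I) euclidean (\<lambda>x. x)"
    by (simp add: euclidean_product_topology)
  from continuous_map_compose[OF this, of euclidean g] assms show ?thesis
    by (simp add: o_def)
qed

text \<open>Precomposing with restriction extends \<open>f\<close> to all functions without changing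
  it on the product space, which makes the locale available.\<close>

lemma finitely_determined_restrict:
  assumes "finite I" "continuous_map (ray_power I) euclidean f"
  shows "finitely_determined I (\<lambda>x. f (restrict x I))"
proof
  show "continuous_on UNIV (\<lambda>x. f (restrict x I))"
    using continuous_map_compose[OF continuous_map_restrict assms(2)] by (simp add: o_def)
  fix x y :: "'a \<Rightarrow> long_ray" assume "\<And>i. i \<in> I \<Longrightarrow> x i = y i"
  then have "restrict x I = restrict y I" by auto
  then show "f (restrict x I) = f (restrict y I)" by simp
qed (rule assms(1))

section \<open>Homotopy invariance and normal forms\<close>

text \<open>Time is the parameter of a separable family of maps on the ray over \<open>T\<close>. If
  the member at time 0 is unbounded, all members fix a common club, so the one at time 1 is
  unbounded.\<close>

lemma homotopic_imp_unbounded_faces_subset: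
  assumes "homotopic_with (\<lambda>_. True) (ray_power I) euclidean f f'"
  shows "unbounded_faces I (\<lambda>x. f (restrict x I)) \<subseteq> unbounded_faces I (\<lambda>x. f' (restrict x I))"
proof
  fix T assume T: "T \<in> unbounded_faces I (\<lambda>x. f (restrict x I))"
  obtain H where H: "continuous_map (prod_topology (top_of_set {0..1::real}) (ray_power I)) euclidean H"
    "\<And>x. H (0, x) = f x" "\<And>x. H (1, x) = f' x"
    using assms unfolding homotopic_with_def by blast
  define h where "h t c = H (t, restrict (ray_map bot T c) I)" for t c
  obtain Q :: "real set" where "countable Q" "Q \<subseteq> {0..1}" "{0..1} \<subseteq> closure Q"
    using separable by blast
  then have Q: "countable Q" "closure Q = {0..1}"
    using closure_minimal[of Q "{0..1}"] by auto
  have ray: "continuous_map euclidean (ray_power I) (\<lambda>c. restrict (ray_map bot T c) I)"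
    unfolding continuous_map_componentwise
  proof (intro conjI ballI)
    fix i assume "i \<in> I"
    then show "continuous_map euclidean euclidean (\<lambda>c. restrict (ray_map bot T c) I i)"
      by (cases "i \<in> T") (simp_all add: ray_map_def)
  qed auto
  then have c1: "continuous_on UNIV (h t)" if "t \<in> {0..1}" for t
    using continuous_map_compose[OF continuous_map_pairedI[OF _ ray] H(1), of "\<lambda>_. t"] that
    by (simp add: o_def h_def[abs_def])
  have c2: "continuous_on {0..1} (\<lambda>t. h t c)" for c
    using continuous_map_compose[OF continuous_map_pairedI H(1), of "top_of_set {0..1}" "\<lambda>t. t"
        "\<lambda>_. restrict (ray_map bot T c) I"]
    by (simp add: o_def h_def)
  have "h 0 = (\<lambda>c. f (restrict (ray_map bot T c) I))" "h 1 = (\<lambda>c. f' (restrict (ray_map bot T c) I))"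
    by (simp_all add: h_def H fun_eq_iff)
  moreover have "\<not> bdd_above (range (h 1))" if "\<not> bdd_above (range (h 0))"
  proof -
    have "club {c. \<forall>t\<in>{0..1}. h t c = c}"
      using unbounded_in_separable_family[of Q h 0] unfolding Q(2) using Q(1) c1 c2 that by auto
    then have "\<exists>c>a. h 1 c = c" for a
      unfolding club_def by fastforce
    then show ?thesis
      unfolding bdd_above_def by (metis leD rangeI)
  qed
  ultimately show "T \<in> unbounded_faces I (\<lambda>x. f' (restrict x I))"
    using T by (simp add: unbounded_faces_def)
qed

lemma homotopic_max_min:
  assumes "finite I" "continuous_map (ray_power I) euclidean f"
  defines "U \<equiv> unbounded_faces I (\<lambda>x. f (restrict x I))"
  shows "minimal_sets U \<in> antichains (Pow I - {{}})"
    and "homotopic_with (\<lambda>_. True) (ray_power I) euclidean f (max_min (minimal_sets U))"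
proof -
  let ?A = "minimal_sets U"
  interpret finitely_determined I "\<lambda>x. f (restrict x I)"
    using assms(1,2) by (rule finitely_determined_restrict)
  \<comment> \<open>The ray over the empty set is constant, so no map is unbounded on it.\<close>
  have "U \<subseteq> Pow I - {{}}"
    by (auto simp: U_def unbounded_faces_def ray_map_def)
  then show A: "?A \<in> antichains (Pow I - {{}})"
    by (rule minimal_sets_antichain)
  have "finite U"
    using \<open>U \<subseteq> _\<close> assms(1) finite_subset[of U "Pow I"] by auto
  define C where "C = {c. (\<forall>x. \<forall>T\<in>U. (\<forall>i\<in>T. c \<le> x i) \<longrightarrow> c \<le> f (restrict x I)) \<and>
    (\<forall>x. \<forall>T\<in>Pow I - U. (\<forall>i\<in>I - T. x i \<le> c) \<longrightarrow> f (restrict x I) \<le> c)}"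
  show "homotopic_with (\<lambda>_. True) (ray_power I) euclidean f (max_min ?A)"
  proof (rule homotopic_if_unseparated[of _ _ _ C])
    show "continuous_map (ray_power I) euclidean (max_min ?A)"
      using finitely_determined.continuous[OF finitely_determined_max_min[OF assms(1) A]]
      by (rule continuous_map_ray_power)
    show "\<exists>c\<in>C. a < c" for a
      using separating_levels_unbounded[of a] unfolding C_def U_def by blast
    fix x c assume "x \<in> topspace (ray_power I)" and c: "c \<in> C"
    then have x: "restrict x I = x" by (simp add: PiE_restrict)
    have above: "c \<le> f x" if "S \<in> U" "\<forall>i\<in>S. c \<le> x i" for S
      using c[unfolded C_def mem_Collect_eq, THEN conjunct1, rule_format, OF that(1), of x] that(2) x
      by simp
    have below: "f x \<le> c" if "T \<in> Pow I - U" "\<forall>i\<in>I - T. x i \<le> c" for T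
      using c[unfolded C_def mem_Collect_eq, THEN conjunct2, rule_format, OF that(1), of x] that(2) x
      by simp
    note le = le_max_min_iff[OF antichains_finite[OF assms(1) A], of c x]
    have "c \<le> f x" if "c \<le> max_min ?A x"
    proof (cases "c = bot")
      case False
      then have "\<exists>S\<in>?A. \<forall>i\<in>S. c \<le> x i" using le that by simp
      then obtain S where "S \<in> ?A" "\<forall>i\<in>S. c \<le> x i" by blast
      moreover have "S \<in> U" using \<open>S \<in> ?A\<close> by (simp add: minimal_sets_def)
      ultimately show ?thesis by (intro above)
    qed simp
    moreover have "f x \<le> c" if "max_min ?A x < c"
    proof -
      \<comment> \<open>Coordinates off \<open>T\<close> are at most \<open>c\<close>. Were
        \<open>T\<close> an unbounded face, a minimal one inside it would give
        \<open>c \<le> max_min ?A x\<close>.\<close>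
      define T where "T = {i \<in> I. c < x i}"
      have "T \<notin> U"
      proof
        assume "T \<in> U"
        then obtain S where "S \<in> ?A" "S \<subseteq> T" using minimal_set_below[OF \<open>finite U\<close>] by blast
        then have "\<forall>i\<in>S. c \<le> x i" by (auto simp: T_def)
        with \<open>S \<in> ?A\<close> have "\<exists>S\<in>?A. \<forall>i\<in>S. c \<le> x i" ..
        with le have "c \<le> max_min ?A x" by simp
        with that show False by simp
      qed
      then have "T \<in> Pow I - U" by (auto simp: T_def)
      moreover have "\<forall>i\<in>I - T. x i \<le> c" by (auto simp: T_def)
      ultimately show ?thesis by (rule below)
    qed
    ultimately show "\<not> (f x < c \<and> c < max_min ?A x) \<and> \<not> (max_min ?A x < c \<and> c < f x)"
      by (meson leD less_imp_le)
  qed (rule assms(2))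
qed

text \<open>The homotopy and its reverse make the upward closed families generated by
  \<open>A\<close> and \<open>B\<close> equal, and their minimal members return \<open>A\<close> and
  \<open>B\<close>.\<close>

lemma max_min_inj:
  assumes "finite I" "A \<in> antichains (Pow I - {{}})" "B \<in> antichains (Pow I - {{}})"
    and "homotopic_with (\<lambda>_. True) (ray_power I) euclidean (max_min A) (max_min B)"
  shows "A = B"
proof -
  have faces: "unbounded_faces I (\<lambda>x. max_min A (restrict x I)) = {T. T \<subseteq> I \<and> (\<exists>S\<in>A. S \<subseteq> T)}"
    if "A \<in> antichains (Pow I - {{}})" for A
  proof -
    have "(\<lambda>x. max_min A (restrict x I)) = max_min A"
      by (intro ext finitely_determined.determined[OF finitely_determined_max_min[OF assms(1) that]]) simp
    then show ?thesis using unbounded_faces_max_min[OF assms(1) that] by simp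
  qed
  have "{T. T \<subseteq> I \<and> (\<exists>S\<in>A. S \<subseteq> T)} = {T. T \<subseteq> I \<and> (\<exists>S\<in>B. S \<subseteq> T)}"
    using homotopic_imp_unbounded_faces_subset[OF assms(4)]
      homotopic_imp_unbounded_faces_subset[OF homotopic_with_symD[OF assms(4)]]
    unfolding faces[OF assms(2)] faces[OF assms(3)] by (rule equalityI)
  from arg_cong[OF this, of minimal_sets] show ?thesis
    unfolding minimal_sets_of_upset[OF assms(2)] minimal_sets_of_upset[OF assms(3)] .
qed

theorem theorem2:
  fixes n :: nat and N :: "nat set"
  assumes "n \<ge> 1" and "N = {1..n}"
  shows "\<exists>F. bij_betw F
    (homotopy_classes (long_ray_power n) (euclidean :: long_ray topology))
    (antichains (Pow N - {{}}))"
proof -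
  let ?X = "long_ray_power n" and ?Y = "euclidean :: long_ray topology"
  let ?r = "{(f, g). homotopic_with (\<lambda>_. True) ?X ?Y f g}"
  have X: "?X = ray_power N" using assms(2) by (simp add: long_ray_power_def)
  have fin: "finite N" using assms(2) by simp
  have continuous: "continuous_map ?X ?Y (max_min A)" if "A \<in> antichains (Pow N - {{}})" for A
    unfolding X
    using finitely_determined.continuous[OF finitely_determined_max_min[OF fin that]]
    by (rule continuous_map_ray_power)
  \<comment> \<open>The bijection is built from antichains to classes, where a representative is
    explicit, and inverted at the end.\<close>
  have "bij_betw (\<lambda>A. ?r `` {max_min A}) (antichains (Pow N - {{}})) (homotopy_classes ?X ?Y)"
  proof (rule bij_betwI')
    fix A B assume A: "A \<in> antichains (Pow N - {{}})" and B: "B \<in> antichains (Pow N - {{}})"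
    then have "?r `` {max_min A} = ?r `` {max_min B} \<longleftrightarrow> (max_min A, max_min B) \<in> ?r"
      by (intro eq_equiv_class_iff[OF equiv_homotopic]) (auto simp: continuous)
    also have "\<dots> \<longleftrightarrow> A = B"
      using max_min_inj[OF fin A B] continuous[OF A] by (auto simp: X)
    finally show "?r `` {max_min A} = ?r `` {max_min B} \<longleftrightarrow> A = B" .
  next
    fix A assume "A \<in> antichains (Pow N - {{}})"
    then show "?r `` {max_min A} \<in> homotopy_classes ?X ?Y"
      unfolding homotopy_classes_def by (intro quotientI) (simp add: continuous)
  next
    fix c assume "c \<in> homotopy_classes ?X ?Y"
    then obtain f where f: "continuous_map ?X ?Y f" "c = ?r `` {f}"
      unfolding homotopy_classes_def by (auto elim: quotientE)
    define A where "A = minimal_sets (unbounded_faces N (\<lambda>x. f (restrict x N)))"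
    have A: "A \<in> antichains (Pow N - {{}})" "homotopic_with (\<lambda>_. True) ?X ?Y f (max_min A)"
      using homotopic_max_min[OF fin, of f] f(1) by (simp_all add: X A_def)
    then have "?r `` {f} = ?r `` {max_min A}"
      by (intro equiv_class_eq[OF equiv_homotopic]) simp
    with A f(2) show "\<exists>A\<in>antichains (Pow N - {{}}). c = ?r `` {max_min A}" by blast
  qed
  then show ?thesis
    using bij_betw_inv_into by blast
qed

end
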